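(* Let $M$ be a $\mathbb{Z}$-module which is projective in $\sigma[M]$. Then $M$ is a semiprime Goldie module if and only if $M$ is semisimple artinian or $M$ is free of finite rank.
   Context: $\sigma[M]$ is the full subcategory of $\mathbb{Z}$-Mod of $M$-subgenerated modules (submodules of quotients of direct sums of copies of $M$). "Projective in $\sigma[M]$" means that $\mathrm{Hom}_{\mathbb{Z}}(M,-)$ is exact on short exact sequences in $\sigma[M]$. A submodule $N\le M$ is fully invariant, $N\leq_{FI}M$, if $f(N)\le N$ for all $f\in \mathrm{End}_{\mathbb{Z}}(M)$. For $N,K\le M$, the product is $N_MK=\sum\{f(N)\mid f\in \mathrm{Hom}_{\mathbb{Z}}(M,K)\}$. $M$ is semiprime if whenever $K\leq_{FI}M$ and $K_MK=0$, then $K=0$. A left annihilator in $M$ is a submodule of the form $\bigcap_{f\in X}\mathrm{Ker}(f)$ for some $X\subseteq \mathrm{End}_{\mathbb{Z}}(M)$. $M$ is a Goldie module if it satisfies ACC on left annihilators and has finite uniform dimension; a semiprime Goldie module is a Goldie module that is semiprime. *)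

theory Defs
  imports "HOL-Algebra.Module" "HOL-Algebra.IntRing"
begin

section \<open>Modules and linear maps\<close>

text \<open>
  Everything is stated for modules over a commutative ring \<open>R\<close>, in the sense of the
  locales \<open>module\<close> and \<open>submodule\<close>. A submodule \<open>N\<close> of \<open>M\<close>, regarded as a module, is
  \<open>M\<lparr>carrier := N\<rparr>\<close>. The fields \<open>mult\<close> and \<open>one\<close> that module records inherit from ring
  records are never used and are left undefined in constructions.
\<close>

text \<open>Maps are extensional, so that equality in \<open>lin_hom R M N\<close> is equality of maps on
  the carrier of \<open>M\<close>.\<close>

definition lin_hom ::
    "('r, 'm) ring_scheme \<Rightarrow> ('r, 'a) module \<Rightarrow> ('r, 'b) module \<Rightarrow> ('a \<Rightarrow> 'b) set" where
  "lin_hom R M N = {f \<in> carrier M \<rightarrow>\<^sub>E carrier N.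
     (\<forall>x\<in>carrier M. \<forall>y\<in>carrier M. f (x \<oplus>\<^bsub>M\<^esub> y) = f x \<oplus>\<^bsub>N\<^esub> f y) \<and>
     (\<forall>r\<in>carrier R. \<forall>x\<in>carrier M. f (r \<odot>\<^bsub>M\<^esub> x) = r \<odot>\<^bsub>N\<^esub> f x)}"

definition lin_isomorphic ::
    "('r, 'm) ring_scheme \<Rightarrow> ('r, 'a) module \<Rightarrow> ('r, 'b) module \<Rightarrow> bool" where
  "lin_isomorphic R M N \<longleftrightarrow> (\<exists>f\<in>lin_hom R M N. bij_betw f (carrier M) (carrier N))"

definition quotient_module :: "('r, 'a) module \<Rightarrow> 'a set \<Rightarrow> ('r, 'a set) module" where
  "quotient_module M K =
     \<lparr>carrier = a_rcosets\<^bsub>M\<^esub> K, monoid.mult = undefined, one = undefined, zero = K, add = set_add M,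
      smult = (\<lambda>r C. \<Union>x\<in>C. K +>\<^bsub>M\<^esub> (r \<odot>\<^bsub>M\<^esub> x))\<rparr>"

text \<open>The direct sum of copies of \<open>M\<close> indexed by \<open>I\<close>.\<close>

definition copower :: "'i set \<Rightarrow> ('r, 'a) module \<Rightarrow> ('r, 'i \<Rightarrow> 'a) module" where
  "copower I M =
     \<lparr>carrier = {f \<in> I \<rightarrow>\<^sub>E carrier M. finite {i \<in> I. f i \<noteq> \<zero>\<^bsub>M\<^esub>}},
      monoid.mult = undefined, one = undefined,
      zero = (\<lambda>i\<in>I. \<zero>\<^bsub>M\<^esub>), add = (\<lambda>f g. \<lambda>i\<in>I. f i \<oplus>\<^bsub>M\<^esub> g i),
      smult = (\<lambda>r f. \<lambda>i\<in>I. r \<odot>\<^bsub>M\<^esub> f i)\<rparr>"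

definition submodule_sum ::
    "('r, 'm) ring_scheme \<Rightarrow> ('r, 'a) module \<Rightarrow> 'a set set \<Rightarrow> 'a set" where
  "submodule_sum R M \<N> = \<Inter>{H. submodule H R M \<and> (\<forall>N\<in>\<N>. N \<subseteq> H)}"


section \<open>The category \<open>\<sigma>[M]\<close> and projectivity in it\<close>

text \<open>
  Membership in \<open>\<sigma>[M]\<close>, up to isomorphism: \<open>N\<close> is a submodule of a quotient of a direct
  sum of copies of \<open>M\<close>. Index sets in the type \<open>'u \<times> nat\<close> suffice for modules over the type
  \<open>'u\<close>: if \<open>N\<close> is embedded in a quotient of \<open>copower J M\<close> for a \<open>J\<close> of any size, choose for
  every element of \<open>N\<close> a representative in \<open>copower J M\<close>; only the elements of \<open>J\<close> in
  one of their finite supports are needed.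
\<close>

definition in_sigma ::
    "('r, 'm) ring_scheme \<Rightarrow> ('r, 'a) module \<Rightarrow> ('r, 'u) module \<Rightarrow> bool" where
  "in_sigma R M N \<longleftrightarrow> module R N \<and>
     (\<exists>(I :: ('u \<times> nat) set) K H.
        submodule K R (copower I M) \<and>
        submodule H R (quotient_module (copower I M) K) \<and>
        lin_isomorphic R N ((quotient_module (copower I M) K)\<lparr>carrier := H\<rparr>))"

text \<open>\<open>0 \<rightarrow> K \<rightarrow> N \<rightarrow> L \<rightarrow> 0\<close> with maps \<open>f\<close> and \<open>g\<close>\<close>

definition short_exact ::
    "('r, 'm) ring_scheme \<Rightarrow> ('r, 'a) module \<Rightarrow> ('r, 'b) module \<Rightarrow> ('r, 'c) module \<Rightarrow>
     ('a \<Rightarrow> 'b) \<Rightarrow> ('b \<Rightarrow> 'c) \<Rightarrow> bool" where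
  "short_exact R K N L f g \<longleftrightarrow>
     f \<in> lin_hom R K N \<and> g \<in> lin_hom R N L \<and>
     inj_on f (carrier K) \<and>
     f ` carrier K = {x \<in> carrier N. g x = \<zero>\<^bsub>L\<^esub>} \<and>
     g ` carrier N = carrier L"

text \<open>\<open>0 \<rightarrow> Hom(M,K) \<rightarrow> Hom(M,N) \<rightarrow> Hom(M,L) \<rightarrow> 0\<close> is exact\<close>

definition hom_short_exact ::
    "('r, 'm) ring_scheme \<Rightarrow> ('r, 'd) module \<Rightarrow>
     ('r, 'a) module \<Rightarrow> ('r, 'b) module \<Rightarrow> ('r, 'c) module \<Rightarrow>
     ('a \<Rightarrow> 'b) \<Rightarrow> ('b \<Rightarrow> 'c) \<Rightarrow> bool" where
  "hom_short_exact R M K N L f g \<longleftrightarrow>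
     inj_on (\<lambda>h. compose (carrier M) f h) (lin_hom R M K) \<and>
     (\<lambda>h. compose (carrier M) f h) ` lin_hom R M K =
       {h \<in> lin_hom R M N. compose (carrier M) g h = (\<lambda>x\<in>carrier M. \<zero>\<^bsub>L\<^esub>)} \<and>
     (\<lambda>h. compose (carrier M) g h) ` lin_hom R M N = lin_hom R M L"

definition hom_exact_on_sigma ::
    "'u itself \<Rightarrow> ('r, 'm) ring_scheme \<Rightarrow> ('r, 'a) module \<Rightarrow> bool" where
  "hom_exact_on_sigma _ R M \<longleftrightarrow>
     (\<forall>(K :: ('r, 'u) module) (N :: ('r, 'u) module) (L :: ('r, 'u) module) f g.
        in_sigma R M K \<and> in_sigma R M N \<and> in_sigma R M L \<and> short_exact R K N L f g \<longrightarrow>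
        hom_short_exact R M K N L f g)"

text \<open>
  A definition cannot quantify over types, so the modules of \<open>\<sigma>[M]\<close> have to be taken over
  a type that is large enough. The type \<open>('r \<times> 'a) list\<close> is, and any larger type gives the
  same notion. \<open>Hom(M,-)\<close> is always left exact, so the question is whether \<open>h\<close> from \<open>M\<close> to
  \<open>L\<close> lifts along a surjection \<open>g\<close> from \<open>N\<close> onto \<open>L\<close>. Choose a preimage \<open>s x\<close> under \<open>g\<close> of
  every \<open>h x\<close>. It suffices to lift \<open>h\<close> along \<open>g\<close> restricted to the submodule of \<open>N\<close>
  generated by the \<open>s x\<close>, onto the image of that submodule, and the elements of this
  submodule are the sums of \<open>r \<odot> s x\<close> over finite lists of pairs \<open>(r, x)\<close>. So it, its image
  and the kernel in between are isomorphic to modules over \<open>('r \<times> 'a) list\<close>, and they are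
  in \<open>\<sigma>[M]\<close>, which is closed under submodules and quotients.
\<close>

definition projective_in_sigma :: "('r, 'm) ring_scheme \<Rightarrow> ('r, 'a) module \<Rightarrow> bool" where
  "projective_in_sigma R M \<longleftrightarrow> hom_exact_on_sigma TYPE(('r \<times> 'a) list) R M"


section \<open>Semiprime Goldie modules\<close>

definition fully_invariant ::
    "('r, 'm) ring_scheme \<Rightarrow> ('r, 'a) module \<Rightarrow> 'a set \<Rightarrow> bool" where
  "fully_invariant R M N \<longleftrightarrow> submodule N R M \<and> (\<forall>f\<in>lin_hom R M M. f ` N \<subseteq> N)"

definition submodule_product ::
    "('r, 'm) ring_scheme \<Rightarrow> ('r, 'a) module \<Rightarrow> 'a set \<Rightarrow> 'a set \<Rightarrow> 'a set" where
  "submodule_product R M N K =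
     submodule_sum R M {f ` N | f. f \<in> lin_hom R M (M\<lparr>carrier := K\<rparr>)}"

definition semiprime_module :: "('r, 'm) ring_scheme \<Rightarrow> ('r, 'a) module \<Rightarrow> bool" where
  "semiprime_module R M \<longleftrightarrow>
     (\<forall>K. fully_invariant R M K \<and> submodule_product R M K K = {\<zero>\<^bsub>M\<^esub>} \<longrightarrow> K = {\<zero>\<^bsub>M\<^esub>})"

text \<open>For \<open>F = {}\<close> this is the empty intersection of submodules of \<open>M\<close>, that is, \<open>M\<close>.\<close>

definition left_annihilator ::
    "('r, 'm) ring_scheme \<Rightarrow> ('r, 'a) module \<Rightarrow> 'a set \<Rightarrow> bool" where
  "left_annihilator R M A \<longleftrightarrow>
     (\<exists>F \<subseteq> lin_hom R M M. A = {x \<in> carrier M. \<forall>f\<in>F. f x = \<zero>\<^bsub>M\<^esub>})"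

definition acc_left_annihilators :: "('r, 'm) ring_scheme \<Rightarrow> ('r, 'a) module \<Rightarrow> bool" where
  "acc_left_annihilators R M \<longleftrightarrow>
     (\<forall>A :: nat \<Rightarrow> 'a set.
        (\<forall>i. left_annihilator R M (A i)) \<and> (\<forall>i. A i \<subseteq> A (Suc i)) \<longrightarrow>
        (\<exists>n. \<forall>m\<ge>n. A m = A n))"

definition uniform_submodule ::
    "('r, 'm) ring_scheme \<Rightarrow> ('r, 'a) module \<Rightarrow> 'a set \<Rightarrow> bool" where
  "uniform_submodule R M U \<longleftrightarrow>
     submodule U R M \<and> U \<noteq> {\<zero>\<^bsub>M\<^esub>} \<and>
     (\<forall>A B. submodule A R M \<and> submodule B R M \<and> A \<subseteq> U \<and> B \<subseteq> U \<and>
            A \<noteq> {\<zero>\<^bsub>M\<^esub>} \<and> B \<noteq> {\<zero>\<^bsub>M\<^esub>} \<longrightarrow> A \<inter> B \<noteq> {\<zero>\<^bsub>M\<^esub>})"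

definition essential_submodule ::
    "('r, 'm) ring_scheme \<Rightarrow> ('r, 'a) module \<Rightarrow> 'a set \<Rightarrow> bool" where
  "essential_submodule R M N \<longleftrightarrow>
     submodule N R M \<and> (\<forall>A. submodule A R M \<and> A \<noteq> {\<zero>\<^bsub>M\<^esub>} \<longrightarrow> N \<inter> A \<noteq> {\<zero>\<^bsub>M\<^esub>})"

definition independent_submodules ::
    "('r, 'a) module \<Rightarrow> nat \<Rightarrow> (nat \<Rightarrow> 'a set) \<Rightarrow> bool" where
  "independent_submodules M n U \<longleftrightarrow>
     (\<forall>u. (\<forall>i<n. u i \<in> U i) \<and> (\<Oplus>\<^bsub>M\<^esub>i\<in>{..<n}. u i) = \<zero>\<^bsub>M\<^esub> \<longrightarrow> (\<forall>i<n. u i = \<zero>\<^bsub>M\<^esub>))"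

text \<open>Some finite direct sum of uniform submodules is essential in \<open>M\<close>.\<close>

definition finite_uniform_dimension :: "('r, 'm) ring_scheme \<Rightarrow> ('r, 'a) module \<Rightarrow> bool" where
  "finite_uniform_dimension R M \<longleftrightarrow>
     (\<exists>n U. (\<forall>i<n. uniform_submodule R M (U i)) \<and> independent_submodules M n U \<and>
            essential_submodule R M (submodule_sum R M (U ` {..<n})))"

definition goldie_module :: "('r, 'm) ring_scheme \<Rightarrow> ('r, 'a) module \<Rightarrow> bool" where
  "goldie_module R M \<longleftrightarrow> acc_left_annihilators R M \<and> finite_uniform_dimension R M"

definition semiprime_goldie_module :: "('r, 'm) ring_scheme \<Rightarrow> ('r, 'a) module \<Rightarrow> bool" where
  "semiprime_goldie_module R M \<longleftrightarrow> goldie_module R M \<and> semiprime_module R M"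


section \<open>Semisimple artinian modules and free modules\<close>

definition simple_submodule ::
    "('r, 'm) ring_scheme \<Rightarrow> ('r, 'a) module \<Rightarrow> 'a set \<Rightarrow> bool" where
  "simple_submodule R M S \<longleftrightarrow>
     submodule S R M \<and> S \<noteq> {\<zero>\<^bsub>M\<^esub>} \<and>
     (\<forall>A. submodule A R M \<and> A \<subseteq> S \<longrightarrow> A = {\<zero>\<^bsub>M\<^esub>} \<or> A = S)"

definition semisimple_module :: "('r, 'm) ring_scheme \<Rightarrow> ('r, 'a) module \<Rightarrow> bool" where
  "semisimple_module R M \<longleftrightarrow> submodule_sum R M {S. simple_submodule R M S} = carrier M"

definition artinian_module :: "('r, 'm) ring_scheme \<Rightarrow> ('r, 'a) module \<Rightarrow> bool" where
  "artinian_module R M \<longleftrightarrow>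
     (\<forall>A :: nat \<Rightarrow> 'a set.
        (\<forall>i. submodule (A i) R M) \<and> (\<forall>i. A (Suc i) \<subseteq> A i) \<longrightarrow>
        (\<exists>n. \<forall>m\<ge>n. A m = A n))"

text \<open>\<open>M\<close> has a finite basis.\<close>

definition free_of_finite_rank :: "('r, 'm) ring_scheme \<Rightarrow> ('r, 'a) module \<Rightarrow> bool" where
  "free_of_finite_rank R M \<longleftrightarrow>
     (\<exists>B. finite B \<and> B \<subseteq> carrier M \<and>
          (\<forall>x\<in>carrier M. \<exists>!c. c \<in> B \<rightarrow>\<^sub>E carrier R \<and> x = (\<Oplus>\<^bsub>M\<^esub>b\<in>B. c b \<odot>\<^bsub>M\<^esub> b)))"

end

(*
  If M is semiprime, K = nM \<inter> {x. nx = 0} is fully invariant and every f : M \<rightarrow> K kills it, because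
  f(nx) = n f(x) = 0. Hence K = 0, that is, n\<^sup>2x = 0 implies nx = 0. For torsion M this makes every
  uniform submodule cyclic of prime order, so finite uniform dimension makes M finite, and M is
  generated by its elements of prime order.

  If M has an element of infinite order, Z embeds in M, the free module on the set M belongs to
  sigma[M], and its projection onto M splits. The coordinates of a section are functionals
  M \<rightarrow> Z whose only common zero is 0. If a functional vanishes at a nonzero element of each uniform
  submodule U i, its kernel contains their essential sum, so the functional is 0. Finitely many functionals
  therefore separate the points of M, and a submodule of Z^n has a finite basis.

  Conversely, complements (Zorn) and the descending chain condition show that a semisimple artinian
  M is a finite direct sum of simple modules, each of prime order, so M is finite. For free M,
  submodules are finitely generated, and x with c(x) \<noteq> 0 gives the map y \<mapsto> c(y)x into any
  submodule containing x.
*)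

theory Submission
  imports Defs
begin

section \<open>Submodules\<close>

text \<open>The case split is torsion against non-torsion, and mixed modules need no case of their
  own: once one element x0 has infinite order, projectivity yields functionals to the integers that
  separate points, and these rule out torsion elements. The role of x0 is to make projectivity in
  \<sigma>[M] reach free modules, since k \<mapsto> k x0 puts the integers into M. The obstacle is
  typing. \<open>projective_in_sigma\<close> quantifies only over modules whose elements are lists
  of pairs, so both the free module and M itself have to be copied into that type before an exact
  sequence can be formed. The module Z^n is never constructed. Its place is taken by a finite set of
  functionals whose only common zero is 0. This hypothesis passes to submodules, which the
  inductions rely on, and it yields bases as well as the chain condition.\<close>

context module
begin

text \<open>Closure under negation follows from closure under scalars, because
  \<open>\<ominus>x = (\<ominus>\<one>) \<odot> x\<close>.\<close>

lemma submodule_iff: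
  "submodule H R M \<longleftrightarrow> H \<subseteq> carrier M \<and> \<zero>\<^bsub>M\<^esub> \<in> H \<and>
     (\<forall>x\<in>H. \<forall>y\<in>H. x \<oplus>\<^bsub>M\<^esub> y \<in> H) \<and> (\<forall>r\<in>carrier R. \<forall>x\<in>H. r \<odot>\<^bsub>M\<^esub> x \<in> H)"
proof (intro iffI conjI ballI)
  assume H: "submodule H R M"
  then interpret submodule H R M .
  show "H \<subseteq> carrier M" "\<zero>\<^bsub>M\<^esub> \<in> H" using submoduleE(1)[OF H] one_closed by auto
  show "x \<oplus>\<^bsub>M\<^esub> y \<in> H" if "x \<in> H" "y \<in> H" for x y using submoduleE(5)[OF H] that by auto
  show "r \<odot>\<^bsub>M\<^esub> x \<in> H" if "r \<in> carrier R" "x \<in> H" for r x using that by auto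
next
  assume H: "H \<subseteq> carrier M \<and> \<zero>\<^bsub>M\<^esub> \<in> H \<and>
     (\<forall>x\<in>H. \<forall>y\<in>H. x \<oplus>\<^bsub>M\<^esub> y \<in> H) \<and> (\<forall>r\<in>carrier R. \<forall>x\<in>H. r \<odot>\<^bsub>M\<^esub> x \<in> H)"
  have "\<ominus>\<^bsub>M\<^esub> x = (\<ominus>\<^bsub>R\<^esub> \<one>\<^bsub>R\<^esub>) \<odot>\<^bsub>M\<^esub> x" if "x \<in> H" for x
    using that H by (subst smult_l_minus) auto
  then show "submodule H R M"
    using H by (intro submoduleI) auto
qed

lemma submodule_subset: "submodule H R M \<Longrightarrow> H \<subseteq> carrier M"
  and submodule_zero: "submodule H R M \<Longrightarrow> \<zero>\<^bsub>M\<^esub> \<in> H"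
  and submodule_add: "submodule H R M \<Longrightarrow> x \<in> H \<Longrightarrow> y \<in> H \<Longrightarrow> x \<oplus>\<^bsub>M\<^esub> y \<in> H"
  and submodule_smult: "submodule H R M \<Longrightarrow> r \<in> carrier R \<Longrightarrow> x \<in> H \<Longrightarrow> r \<odot>\<^bsub>M\<^esub> x \<in> H"
  by (auto simp: submodule_iff)

lemma submodule_carrier: "submodule H R M \<Longrightarrow> x \<in> H \<Longrightarrow> x \<in> carrier M"
  using submodule_subset by blast

lemma submodule_minus: "submodule H R M \<Longrightarrow> x \<in> H \<Longrightarrow> \<ominus>\<^bsub>M\<^esub> x \<in> H"
  by (rule submoduleE(3))

text \<open>Serves in place of subtraction whenever a summand is to be located in a
  submodule.\<close>

lemma submodule_add_cancel:
  assumes "submodule H R M" "x \<in> carrier M" "y \<in> H" "x \<oplus>\<^bsub>M\<^esub> y \<in> H"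
  shows "x \<in> H"
proof -
  have "y \<in> carrier M" using assms submodule_carrier by blast
  then have "(x \<oplus>\<^bsub>M\<^esub> y) \<oplus>\<^bsub>M\<^esub> (\<ominus>\<^bsub>M\<^esub> y) = x"
    using assms(2) by (simp add: M.a_assoc M.r_neg)
  moreover have "(x \<oplus>\<^bsub>M\<^esub> y) \<oplus>\<^bsub>M\<^esub> (\<ominus>\<^bsub>M\<^esub> y) \<in> H"
    by (intro submodule_add[OF assms(1)] submodule_minus assms)
  ultimately show ?thesis by simp
qed

lemma zero_submodule: "submodule {\<zero>\<^bsub>M\<^esub>} R M"
  by (auto simp: submodule_iff)

lemma Int_submodule: "submodule A R M \<Longrightarrow> submodule B R M \<Longrightarrow> submodule (A \<inter> B) R M"
  by (auto simp: submodule_iff)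

lemma set_add_submodule:
  assumes A: "submodule A R M" and B: "submodule B R M"
  shows "submodule (A <+>\<^bsub>M\<^esub> B) R M"
  unfolding submodule_iff set_add_def'
proof (intro conjI ballI)
  show "(\<Union>h\<in>A. \<Union>k\<in>B. {h \<oplus>\<^bsub>M\<^esub> k}) \<subseteq> carrier M"
    using submodule_carrier[OF A] submodule_carrier[OF B] by auto
  show "\<zero>\<^bsub>M\<^esub> \<in> (\<Union>h\<in>A. \<Union>k\<in>B. {h \<oplus>\<^bsub>M\<^esub> k})"
    using submodule_zero[OF A] submodule_zero[OF B] by force
next
  fix x y
  assume "x \<in> (\<Union>h\<in>A. \<Union>k\<in>B. {h \<oplus>\<^bsub>M\<^esub> k})" "y \<in> (\<Union>h\<in>A. \<Union>k\<in>B. {h \<oplus>\<^bsub>M\<^esub> k})"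
  then obtain a b a' b' where
    *: "a \<in> A" "b \<in> B" "x = a \<oplus>\<^bsub>M\<^esub> b" "a' \<in> A" "b' \<in> B" "y = a' \<oplus>\<^bsub>M\<^esub> b'" by auto
  then have "a \<in> carrier M" "b \<in> carrier M" "a' \<in> carrier M" "b' \<in> carrier M"
    using submodule_carrier[OF A] submodule_carrier[OF B] by auto
  then have "x \<oplus>\<^bsub>M\<^esub> y = (a \<oplus>\<^bsub>M\<^esub> a') \<oplus>\<^bsub>M\<^esub> (b \<oplus>\<^bsub>M\<^esub> b')"
    using * by (simp add: M.a_ac)
  then show "x \<oplus>\<^bsub>M\<^esub> y \<in> (\<Union>h\<in>A. \<Union>k\<in>B. {h \<oplus>\<^bsub>M\<^esub> k})"
    using submodule_add[OF A *(1,4)] submodule_add[OF B *(2,5)] by auto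
next
  fix r x
  assume r: "r \<in> carrier R" and "x \<in> (\<Union>h\<in>A. \<Union>k\<in>B. {h \<oplus>\<^bsub>M\<^esub> k})"
  then obtain a b where *: "a \<in> A" "b \<in> B" "x = a \<oplus>\<^bsub>M\<^esub> b" by auto
  then have "r \<odot>\<^bsub>M\<^esub> x = r \<odot>\<^bsub>M\<^esub> a \<oplus>\<^bsub>M\<^esub> r \<odot>\<^bsub>M\<^esub> b"
    using r submodule_carrier[OF A] submodule_carrier[OF B] by (simp add: smult_r_distr)
  then show "r \<odot>\<^bsub>M\<^esub> x \<in> (\<Union>h\<in>A. \<Union>k\<in>B. {h \<oplus>\<^bsub>M\<^esub> k})"
    using submodule_smult[OF A r *(1)] submodule_smult[OF B r *(2)] by auto
qed

lemma set_add_iff: "x \<in> A <+>\<^bsub>M\<^esub> B \<longleftrightarrow> (\<exists>a\<in>A. \<exists>b\<in>B. x = a \<oplus>\<^bsub>M\<^esub> b)"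
  by (auto simp: set_add_def')

lemma set_add_upper:
  assumes "submodule A R M" "submodule B R M"
  shows "A \<subseteq> A <+>\<^bsub>M\<^esub> B" "B \<subseteq> A <+>\<^bsub>M\<^esub> B"
proof -
  show "A \<subseteq> A <+>\<^bsub>M\<^esub> B"
  proof
    fix x assume "x \<in> A"
    then have "x = x \<oplus>\<^bsub>M\<^esub> \<zero>\<^bsub>M\<^esub>" using submodule_carrier[OF assms(1)] by simp
    then show "x \<in> A <+>\<^bsub>M\<^esub> B" unfolding set_add_iff
      using \<open>x \<in> A\<close> submodule_zero[OF assms(2)] by blast
  qed
  show "B \<subseteq> A <+>\<^bsub>M\<^esub> B"
  proof
    fix x assume "x \<in> B"
    then have "x = \<zero>\<^bsub>M\<^esub> \<oplus>\<^bsub>M\<^esub> x" using submodule_carrier[OF assms(2)] by simp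
    then show "x \<in> A <+>\<^bsub>M\<^esub> B" unfolding set_add_iff
      using \<open>x \<in> B\<close> submodule_zero[OF assms(1)] by blast
  qed
qed

lemma set_add_least:
  assumes "submodule H R M" "A \<subseteq> H" "B \<subseteq> H"
  shows "A <+>\<^bsub>M\<^esub> B \<subseteq> H"
  using assms submodule_add[OF assms(1)] unfolding set_add_def' by auto

end

text \<open>\<open>submodule_sum\<close> and the notions built on it take plain module records, without the
  extension fields that the locale \<open>module\<close> allows.\<close>

locale plain_module = module R M
  for R (structure) and M :: "('r, 'a) module" (structure)
begin

lemma submodule_sum_upper: "N \<in> \<N> \<Longrightarrow> N \<subseteq> submodule_sum R M \<N>"
  by (auto simp: submodule_sum_def)

lemma submodule_sum_least:
  "submodule H R M \<Longrightarrow> (\<And>N. N \<in> \<N> \<Longrightarrow> N \<subseteq> H) \<Longrightarrow> submodule_sum R M \<N> \<subseteq> H"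
  by (auto simp: submodule_sum_def)

text \<open>The hypothesis makes the carrier one of the submodules that \<open>submodule_sum\<close>
  intersects, so the intersection stays inside the carrier.\<close>

lemma submodule_sum_submodule:
  assumes "\<And>N. N \<in> \<N> \<Longrightarrow> submodule N R M"
  shows "submodule (submodule_sum R M \<N>) R M"
proof -
  have "\<forall>N\<in>\<N>. N \<subseteq> carrier M"
    using assms submodule_subset by blast
  with carrier_is_submodule have "submodule_sum R M \<N> \<subseteq> carrier M"
    unfolding submodule_sum_def by blast
  then show ?thesis
    unfolding submodule_iff[of "submodule_sum R M \<N>"]
    by (auto simp: submodule_sum_def submodule_zero submodule_add submodule_smult)
qed

lemma submodule_sum_empty: "submodule_sum R M {} = {\<zero>\<^bsub>M\<^esub>}"
  using submodule_sum_least[OF zero_submodule, of "{}"]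
    submodule_zero[OF submodule_sum_submodule, of "{}"] by auto

text \<open>Makes finite sums accessible to induction, since \<open>submodule_sum\<close> itself is
  an intersection.\<close>

lemma submodule_sum_Suc:
  assumes "\<And>i. i < Suc n \<Longrightarrow> submodule (U i) R M"
  shows "submodule_sum R M (U ` {..<Suc n}) = submodule_sum R M (U ` {..<n}) <+>\<^bsub>M\<^esub> U n"
proof (rule antisym)
  have n: "submodule (submodule_sum R M (U ` {..<n})) R M"
    using assms by (intro submodule_sum_submodule) auto
  have "submodule (submodule_sum R M (U ` {..<Suc n})) R M"
    using assms by (intro submodule_sum_submodule) auto
  moreover have "submodule_sum R M (U ` {..<n}) \<subseteq> submodule_sum R M (U ` {..<Suc n})"
    unfolding submodule_sum_def by auto
  ultimately show "submodule_sum R M (U ` {..<n}) <+>\<^bsub>M\<^esub> U n \<subseteq> submodule_sum R M (U ` {..<Suc n})"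
    using submodule_sum_upper[of "U n" "U ` {..<Suc n}"] by (intro set_add_least) auto
  show "submodule_sum R M (U ` {..<Suc n}) \<subseteq> submodule_sum R M (U ` {..<n}) <+>\<^bsub>M\<^esub> U n"
  proof (rule submodule_sum_least)
    show "submodule (submodule_sum R M (U ` {..<n}) <+>\<^bsub>M\<^esub> U n) R M"
      using n assms by (intro set_add_submodule) auto
    fix N assume "N \<in> U ` {..<Suc n}"
    then consider "N = U n" | "N \<in> U ` {..<n}" by (auto simp: less_Suc_eq)
    then show "N \<subseteq> submodule_sum R M (U ` {..<n}) <+>\<^bsub>M\<^esub> U n"
    proof cases
      case 1
      then show ?thesis using set_add_upper(2)[OF n] assms by blast
    next
      case 2
      have "submodule_sum R M (U ` {..<n}) \<subseteq> submodule_sum R M (U ` {..<n}) <+>\<^bsub>M\<^esub> U n"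
        using set_add_upper(1)[OF n] assms by blast
      then show ?thesis using submodule_sum_upper[OF 2] by blast
    qed
  qed
qed

lemma finite_submodule_sum:
  fixes n :: nat
  assumes "\<And>i. i < n \<Longrightarrow> submodule (U i) R M" "\<And>i. i < n \<Longrightarrow> finite (U i)"
  shows "finite (submodule_sum R M (U ` {..<n}))"
  using assms
proof (induction n)
  case 0
  then show ?case by (simp add: submodule_sum_empty)
next
  case (Suc n)
  then show ?case by (subst submodule_sum_Suc) (auto simp: set_add_def')
qed

lemma finsum_in_submodule:
  assumes "submodule H R M" "\<And>i. i \<in> A \<Longrightarrow> f i \<in> H"
  shows "(\<Oplus>\<^bsub>M\<^esub>i\<in>A. f i) \<in> H"
  using assms(2)
proof (induction A rule: infinite_finite_induct)
  case (insert x F)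
  then have "f \<in> F \<rightarrow> carrier M" "f x \<in> carrier M" using submodule_carrier[OF assms(1)] by auto
  with insert show ?case by (simp add: submodule_add[OF assms(1)])
qed (simp_all add: submodule_zero[OF assms(1)])

end


section \<open>Semisimple modules\<close>

context plain_module
begin

text \<open>Zorn's lemma gives a C maximal among the submodules that meet N trivially. A simple S
  not inside N + C would meet N + C trivially, so C + S would still meet N trivially, against
  maximality. Hence N + C contains every simple submodule.\<close>

lemma semisimple_complement:
  assumes M: "semisimple_module R M" and N: "submodule N R M"
  obtains C where "submodule C R M" "N \<inter> C = {\<zero>\<^bsub>M\<^esub>}" "N <+>\<^bsub>M\<^esub> C = carrier M"
proof -
  define \<S> where "\<S> = {C. submodule C R M \<and> N \<inter> C = {\<zero>\<^bsub>M\<^esub>}}"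
  have "{\<zero>\<^bsub>M\<^esub>} \<in> \<S>"
    using zero_submodule submodule_zero[OF N] by (auto simp: \<S>_def)
  moreover have "\<Union>\<C> \<in> \<S>" if "\<C> \<noteq> {}" and chain: "subset.chain \<S> \<C>" for \<C>
  proof -
    have sub: "submodule C R M" "N \<inter> C = {\<zero>\<^bsub>M\<^esub>}" if "C \<in> \<C>" for C
      using chain that by (auto simp: subset.chain_def \<S>_def)
    have "submodule (\<Union>\<C>) R M"
      unfolding submodule_iff
    proof (intro conjI ballI)
      show "\<Union>\<C> \<subseteq> carrier M" using sub(1) submodule_subset by blast
      show "\<zero>\<^bsub>M\<^esub> \<in> \<Union>\<C>" using that(1) sub(1) submodule_zero by blast
      show "r \<odot>\<^bsub>M\<^esub> x \<in> \<Union>\<C>" if "r \<in> carrier R" "x \<in> \<Union>\<C>" for r x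
        using that sub(1) submodule_smult by blast
      fix x y assume "x \<in> \<Union>\<C>" "y \<in> \<Union>\<C>"
      then obtain X Y where *: "X \<in> \<C>" "x \<in> X" "Y \<in> \<C>" "y \<in> Y" by blast
      then have "X \<subseteq> Y \<or> Y \<subseteq> X" using chain by (auto simp: subset.chain_def)
      then obtain Z where "Z \<in> \<C>" "x \<in> Z" "y \<in> Z" using * by blast
      then show "x \<oplus>\<^bsub>M\<^esub> y \<in> \<Union>\<C>" using sub(1) submodule_add by blast
    qed
    then show ?thesis using that(1) sub(2) by (auto simp: \<S>_def)
  qed
  ultimately obtain C where "C \<in> \<S>" and max: "\<And>X. X \<in> \<S> \<Longrightarrow> C \<subseteq> X \<Longrightarrow> X = C"
    using subset_Zorn_nonempty[of \<S>] by blast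
  then have C: "submodule C R M" and NC: "N \<inter> C = {\<zero>\<^bsub>M\<^esub>}" by (auto simp: \<S>_def)
  have sum: "submodule (N <+>\<^bsub>M\<^esub> C) R M" by (rule set_add_submodule[OF N C])
  have "S \<subseteq> N <+>\<^bsub>M\<^esub> C" if "simple_submodule R M S" for S
  proof (rule ccontr)
    assume "\<not> S \<subseteq> N <+>\<^bsub>M\<^esub> C"
    moreover have S: "submodule S R M" using that by (auto simp: simple_submodule_def)
    ultimately have triv: "S \<inter> (N <+>\<^bsub>M\<^esub> C) = {\<zero>\<^bsub>M\<^esub>}"
      using that Int_submodule[OF S sum] by (auto simp: simple_submodule_def)
    have CS: "submodule (C <+>\<^bsub>M\<^esub> S) R M" by (rule set_add_submodule[OF C S])
    \<comment> \<open>If x = c + s lies in N, then s = x - c lies in N + C, so s = 0 and x = c lies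
      in N \<inter> C.\<close>
    have "N \<inter> (C <+>\<^bsub>M\<^esub> S) \<subseteq> {\<zero>\<^bsub>M\<^esub>}"
    proof
      fix x assume x: "x \<in> N \<inter> (C <+>\<^bsub>M\<^esub> S)"
      then obtain c s where cs: "c \<in> C" "s \<in> S" "x = c \<oplus>\<^bsub>M\<^esub> s" by (auto simp: set_add_iff)
      have car: "c \<in> carrier M" "s \<in> carrier M"
        using cs submodule_carrier C S by auto
      have "s \<in> N <+>\<^bsub>M\<^esub> C"
      proof (rule submodule_add_cancel[OF sum car(2)])
        show "c \<in> N <+>\<^bsub>M\<^esub> C" using set_add_upper(2)[OF N C] cs by blast
        show "s \<oplus>\<^bsub>M\<^esub> c \<in> N <+>\<^bsub>M\<^esub> C"
          using x cs car set_add_upper(1)[OF N C] by (auto simp: M.a_comm)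
      qed
      then have "s = \<zero>\<^bsub>M\<^esub>" using triv cs by blast
      then show "x \<in> {\<zero>\<^bsub>M\<^esub>}" using NC x cs car by auto
    qed
    then have "C <+>\<^bsub>M\<^esub> S \<in> \<S>"
      using CS submodule_zero[OF N] submodule_zero[OF CS] by (auto simp: \<S>_def)
    then have "C <+>\<^bsub>M\<^esub> S = C"
      using max set_add_upper(1)[OF C S] by blast
    then have "S \<subseteq> N <+>\<^bsub>M\<^esub> C"
      using set_add_upper(2)[OF C S] set_add_upper(2)[OF N C] by blast
    with \<open>\<not> S \<subseteq> N <+>\<^bsub>M\<^esub> C\<close> show False ..
  qed
  then have "submodule_sum R M {S. simple_submodule R M S} \<subseteq> N <+>\<^bsub>M\<^esub> C"
    by (intro submodule_sum_least[OF sum]) auto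
  then have "N <+>\<^bsub>M\<^esub> C = carrier M"
    using M submodule_subset[OF sum] by (auto simp: semisimple_module_def)
  then show thesis using that C NC by blast
qed

text \<open>The difference a - a' equals b' - b and therefore lies in A \<inter> B.\<close>

lemma direct_sum_cancel:
  assumes "submodule A R M" "submodule B R M" "A \<inter> B = {\<zero>\<^bsub>M\<^esub>}"
    and "a \<in> A" "a' \<in> A" "b \<in> B" "b' \<in> B" "a \<oplus>\<^bsub>M\<^esub> b = a' \<oplus>\<^bsub>M\<^esub> b'"
  shows "a = a'"
proof -
  have car: "a \<in> carrier M" "a' \<in> carrier M" "b \<in> carrier M" "b' \<in> carrier M"
    using assms submodule_carrier by auto
  have "(a \<ominus>\<^bsub>M\<^esub> a') \<oplus>\<^bsub>M\<^esub> b = \<ominus>\<^bsub>M\<^esub> a' \<oplus>\<^bsub>M\<^esub> (a \<oplus>\<^bsub>M\<^esub> b)"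
    using car by (simp add: M.minus_eq M.a_ac)
  also have "\<dots> = b'"
    using car by (simp add: assms(8) M.a_assoc[symmetric] M.l_neg)
  finally have "(a \<ominus>\<^bsub>M\<^esub> a') \<oplus>\<^bsub>M\<^esub> b = b'" .
  then have "a \<ominus>\<^bsub>M\<^esub> a' \<in> B"
    using submodule_add_cancel[OF assms(2), of "a \<ominus>\<^bsub>M\<^esub> a'" b] car assms by simp
  moreover have "a \<ominus>\<^bsub>M\<^esub> a' \<in> A"
    unfolding M.minus_eq using assms by (intro submodule_add submodule_minus)
  ultimately have "a \<ominus>\<^bsub>M\<^esub> a' = \<zero>\<^bsub>M\<^esub>" using assms(3) by blast
  then show ?thesis using car by (metis M.minus_eq M.add.inv_closed M.minus_equality M.minus_minus)
qed

text \<open>One map from M to K that does not vanish on K already makes the product of K with itself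
  nonzero.\<close>

lemma semiprime_moduleI:
  assumes "\<And>K. fully_invariant R M K \<Longrightarrow> K \<noteq> {\<zero>\<^bsub>M\<^esub>} \<Longrightarrow>
    \<exists>f \<in> lin_hom R M (M\<lparr>carrier := K\<rparr>). \<exists>x\<in>K. f x \<noteq> \<zero>\<^bsub>M\<^esub>"
  shows "semiprime_module R M"
  unfolding semiprime_module_def
proof (intro allI impI, rule ccontr)
  fix K
  assume K: "fully_invariant R M K \<and> submodule_product R M K K = {\<zero>\<^bsub>M\<^esub>}"
    and "K \<noteq> {\<zero>\<^bsub>M\<^esub>}"
  then obtain f x where "f \<in> lin_hom R M (M\<lparr>carrier := K\<rparr>)" "x \<in> K" "f x \<noteq> \<zero>\<^bsub>M\<^esub>"
    using assms by blast
  moreover from this have "f ` K \<subseteq> submodule_product R M K K"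
    unfolding submodule_product_def by (intro submodule_sum_upper) auto
  ultimately show False using K by auto
qed

text \<open>The projection onto K along a complement maps M into K and is the identity on K.\<close>

lemma semisimple_imp_semiprime:
  assumes M: "semisimple_module R M"
  shows "semiprime_module R M"
proof (rule semiprime_moduleI)
  fix K assume "fully_invariant R M K" and nz: "K \<noteq> {\<zero>\<^bsub>M\<^esub>}"
  then have K: "submodule K R M" by (simp add: fully_invariant_def)
  obtain C where C: "submodule C R M" "K \<inter> C = {\<zero>\<^bsub>M\<^esub>}" "K <+>\<^bsub>M\<^esub> C = carrier M"
    using semisimple_complement[OF M K] .
  have "\<forall>x\<in>carrier M. \<exists>k\<in>K. \<exists>c\<in>C. x = k \<oplus>\<^bsub>M\<^esub> c"
    using C(3) by (auto simp: set_add_iff)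
  then obtain k c where kc: "\<And>x. x \<in> carrier M \<Longrightarrow> k x \<in> K \<and> c x \<in> C \<and> x = k x \<oplus>\<^bsub>M\<^esub> c x"
    by metis
  \<comment> \<open>Uniqueness of the K-component. Each identity for k below is obtained by
    exhibiting a decomposition of the argument, with b as its C-component.\<close>
  have k: "k x = a" if "x \<in> carrier M" "a \<in> K" "b \<in> C" "x = a \<oplus>\<^bsub>M\<^esub> b" for x a b
    using direct_sum_cancel[OF K C(1,2)] kc[OF that(1)] that by metis
  have car: "k x \<in> carrier M" "c x \<in> carrier M" if "x \<in> carrier M" for x
    using kc[OF that] submodule_carrier K C by auto
  let ?f = "restrict k (carrier M)"
  have "?f \<in> lin_hom R M (M\<lparr>carrier := K\<rparr>)"
    unfolding lin_hom_def
  proof (intro CollectI conjI ballI)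
    show "?f \<in> carrier M \<rightarrow>\<^sub>E carrier (M\<lparr>carrier := K\<rparr>)" using kc by auto
  next
    fix x y assume xy: "x \<in> carrier M" "y \<in> carrier M"
    have "x \<oplus>\<^bsub>M\<^esub> y = (k x \<oplus>\<^bsub>M\<^esub> c x) \<oplus>\<^bsub>M\<^esub> (k y \<oplus>\<^bsub>M\<^esub> c y)"
      using kc xy by simp
    also have "\<dots> = (k x \<oplus>\<^bsub>M\<^esub> k y) \<oplus>\<^bsub>M\<^esub> (c x \<oplus>\<^bsub>M\<^esub> c y)"
      using car xy by (simp add: M.a_ac)
    finally have "k (x \<oplus>\<^bsub>M\<^esub> y) = k x \<oplus>\<^bsub>M\<^esub> k y"
      using xy kc car K C(1) by (intro k[where b = "c x \<oplus>\<^bsub>M\<^esub> c y"]) (simp_all add: submodule_add)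
    then show "?f (x \<oplus>\<^bsub>M\<^esub> y) = ?f x \<oplus>\<^bsub>M\<lparr>carrier := K\<rparr>\<^esub> ?f y" using xy by simp
  next
    fix r x assume rx: "r \<in> carrier R" "x \<in> carrier M"
    have "r \<odot>\<^bsub>M\<^esub> x = r \<odot>\<^bsub>M\<^esub> (k x \<oplus>\<^bsub>M\<^esub> c x)" using kc rx by simp
    also have "\<dots> = r \<odot>\<^bsub>M\<^esub> k x \<oplus>\<^bsub>M\<^esub> r \<odot>\<^bsub>M\<^esub> c x"
      using rx car by (simp add: smult_r_distr)
    finally have "k (r \<odot>\<^bsub>M\<^esub> x) = r \<odot>\<^bsub>M\<^esub> k x"
      using rx kc car K C(1) by (intro k[where b = "r \<odot>\<^bsub>M\<^esub> c x"]) (simp_all add: submodule_smult)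
    then show "?f (r \<odot>\<^bsub>M\<^esub> x) = r \<odot>\<^bsub>M\<lparr>carrier := K\<rparr>\<^esub> ?f x" using rx by simp
  qed
  moreover obtain x where x: "x \<in> K" "x \<noteq> \<zero>\<^bsub>M\<^esub>" using nz submodule_zero[OF K] by blast
  moreover have "k x = x"
    using x submodule_carrier[OF K] submodule_zero[OF C(1)] by (intro k[where b = "\<zero>\<^bsub>M\<^esub>"]) auto
  ultimately show "\<exists>f \<in> lin_hom R M (M\<lparr>carrier := K\<rparr>). \<exists>x\<in>K. f x \<noteq> \<zero>\<^bsub>M\<^esub>"
    using submodule_carrier[OF K] by (intro bexI[of _ ?f] bexI[of _ x]) auto
qed

text \<open>If no member were minimal, iterating a choice of strictly smaller members would produce
  an infinite strictly descending chain.\<close>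

lemma artinian_minimal:
  assumes M: "artinian_module R M" and "C0 \<in> \<S>" and sub: "\<And>C. C \<in> \<S> \<Longrightarrow> submodule C R M"
  obtains C where "C \<in> \<S>" "\<And>D. D \<in> \<S> \<Longrightarrow> \<not> D \<subset> C"
proof (rule ccontr)
  assume "\<not> thesis"
  with that have "\<forall>C. \<exists>D. C \<in> \<S> \<longrightarrow> D \<in> \<S> \<and> D \<subset> C" by blast
  then obtain f where f: "\<And>C. C \<in> \<S> \<Longrightarrow> f C \<in> \<S> \<and> f C \<subset> C" by metis
  define A where "A = (\<lambda>i. (f ^^ i) C0)"
  have A: "A i \<in> \<S>" for i
    by (induction i) (use f \<open>C0 \<in> \<S>\<close> in \<open>auto simp: A_def\<close>)
  have "A (Suc i) \<subset> A i" for i using f[OF A[of i]] by (simp add: A_def)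
  moreover from this obtain n where "\<forall>m\<ge>n. A m = A n"
    using M A sub unfolding artinian_module_def by (metis psubset_imp_subset)
  ultimately show False by (metis le_SucI order.refl psubset_eq)
qed

lemma simple_imp_uniform: "simple_submodule R M S \<Longrightarrow> uniform_submodule R M S"
  unfolding simple_submodule_def uniform_submodule_def by blast

end

section \<open>Torsion and semisimplicity over the integers\<close>

locale int_module = plain_module \<Z> M
  for M :: "(int, 'a) module" (structure)
begin

lemma int_submodule_iff:
  "submodule H \<Z> M \<longleftrightarrow> H \<subseteq> carrier M \<and> \<zero> \<in> H \<and>
     (\<forall>x\<in>H. \<forall>y\<in>H. x \<oplus> y \<in> H) \<and> (\<forall>k. \<forall>x\<in>H. k \<odot> x \<in> H)"
  using submodule_iff[of H] by simp

lemma smult_in: "submodule H \<Z> M \<Longrightarrow> x \<in> H \<Longrightarrow> k \<odot> x \<in> H"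
  by (simp add: int_submodule_iff)

lemma smult_carrier [simp]: "x \<in> carrier M \<Longrightarrow> k \<odot> x \<in> carrier M"
  using smult_closed[of k x] by simp

lemma smult_distribs:
  "x \<in> carrier M \<Longrightarrow> (k + l) \<odot> x = k \<odot> x \<oplus> l \<odot> x"
  "x \<in> carrier M \<Longrightarrow> y \<in> carrier M \<Longrightarrow> k \<odot> (x \<oplus> y) = k \<odot> x \<oplus> k \<odot> y"
  using smult_l_distr[of k l x] smult_r_distr[of k x y] by simp_all

lemma smult_smult: "x \<in> carrier M \<Longrightarrow> k \<odot> (l \<odot> x) = (k * l) \<odot> x"
  using smult_assoc1[of k l x] by simp

lemma int_smult_simps [simp]:
  "x \<in> carrier M \<Longrightarrow> 1 \<odot> x = x"
  "x \<in> carrier M \<Longrightarrow> 0 \<odot> x = \<zero>"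
  "k \<odot> \<zero> = \<zero>"
  using smult_one[of x] smult_l_null[of x] smult_r_null[of k] by simp_all

lemma smult_dvd:
  assumes "x \<in> carrier M" "k \<odot> x = \<zero>" "k dvd l"
  shows "l \<odot> x = \<zero>"
proof -
  from assms(3) obtain m where "l = m * k" by (metis dvdE mult.commute)
  then show ?thesis using assms(1,2) smult_smult[of x m k] by simp
qed

lemma smult_mod:
  assumes "x \<in> carrier M" "p \<odot> x = \<zero>"
  shows "k \<odot> x = (k mod p) \<odot> x"
proof -
  have "k \<odot> x = (p * (k div p) + k mod p) \<odot> x" by simp
  also have "\<dots> = (p * (k div p)) \<odot> x \<oplus> (k mod p) \<odot> x"
    using assms(1) by (rule smult_distribs)
  also have "(p * (k div p)) \<odot> x = \<zero>"
    using assms by (rule smult_dvd) simp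
  finally show ?thesis using assms(1) by simp
qed

lemma coprime_decompose:
  assumes "x \<in> carrier M" "coprime k l"
  obtains a b where "x = a \<odot> (k \<odot> x) \<oplus> b \<odot> (l \<odot> x)"
proof -
  obtain a b where "a * k + b * l = 1"
    using assms(2) by (metis bezout_int coprime_imp_gcd_eq_1)
  then have "x = (a * k + b * l) \<odot> x" using assms(1) by simp
  also have "\<dots> = a \<odot> (k \<odot> x) \<oplus> b \<odot> (l \<odot> x)"
    using assms(1) by (simp only: smult_distribs smult_smult)
  finally show thesis by (rule that)
qed

lemma coprime_kill:
  assumes "x \<in> carrier M" "coprime k l" "k \<odot> x = \<zero>" "l \<odot> x = \<zero>"
  shows "x = \<zero>"
  using coprime_decompose[OF assms(1,2)] assms(3,4) by auto

definition cyclic :: "'a \<Rightarrow> 'a set" where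
  "cyclic x = range (\<lambda>k. k \<odot> x)"

lemma cyclic_self: "x \<in> carrier M \<Longrightarrow> x \<in> cyclic x"
  unfolding cyclic_def by (rule range_eqI[of _ _ 1]) simp

lemma cyclic_submodule: "x \<in> carrier M \<Longrightarrow> submodule (cyclic x) \<Z> M"
  unfolding int_submodule_iff cyclic_def
  by (auto simp: smult_distribs[symmetric] smult_smult intro: range_eqI[of _ _ 0])

lemma cyclic_least: "submodule H \<Z> M \<Longrightarrow> x \<in> H \<Longrightarrow> cyclic x \<subseteq> H"
  by (auto simp: cyclic_def smult_in)

lemma cyclic_neq_zero: "x \<in> carrier M \<Longrightarrow> x \<noteq> \<zero> \<Longrightarrow> cyclic x \<noteq> {\<zero>}"
  using cyclic_self by blast

lemma finite_cyclic:
  assumes "x \<in> carrier M" "p \<odot> x = \<zero>" "p > 0"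
  shows "finite (cyclic x)"
proof (rule finite_subset)
  show "cyclic x \<subseteq> (\<lambda>k. k \<odot> x) ` {0..<p}"
    unfolding cyclic_def
    using smult_mod[OF assms(1,2)] assms(3) by (auto intro!: image_eqI[of _ _ "_ mod p"])
qed simp

text \<open>As k does not kill x, it is not divisible by p. So k is invertible modulo p, and x is
  recovered from its multiple.\<close>

lemma prime_not_kill:
  assumes "x \<in> carrier M" "prime p" "p \<odot> x = \<zero>" "k \<odot> x \<noteq> \<zero>"
  obtains a where "x = a \<odot> (k \<odot> x)"
proof -
  have "\<not> p dvd k" using assms smult_dvd by blast
  then have "coprime p k" using assms(2) prime_imp_coprime by blast
  then obtain a b where "x = a \<odot> (p \<odot> x) \<oplus> b \<odot> (k \<odot> x)"
    using coprime_decompose[OF assms(1)] by blast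
  then have "x = b \<odot> (k \<odot> x)" using assms(1,3) by simp
  then show thesis by (rule that)
qed

text \<open>A nonzero submodule contains a nonzero multiple of x, from which
  \<open>prime_not_kill\<close> recovers x.\<close>

lemma prime_cyclic_simple:
  assumes "x \<in> carrier M" "x \<noteq> \<zero>" "prime p" "p \<odot> x = \<zero>"
  shows "simple_submodule \<Z> M (cyclic x)"
  unfolding simple_submodule_def
proof (intro conjI allI impI)
  fix A assume A: "submodule A \<Z> M \<and> A \<subseteq> cyclic x"
  show "A = {\<zero>} \<or> A = cyclic x"
  proof (cases "A = {\<zero>}")
    case False
    then obtain k where k: "k \<odot> x \<in> A" "k \<odot> x \<noteq> \<zero>"
      using A submodule_zero[of A] unfolding cyclic_def by blast
    obtain a where "x = a \<odot> (k \<odot> x)"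
      using prime_not_kill[OF assms(1,3,4) k(2)] .
    then have "x \<in> A" using A k smult_in by metis
    then show ?thesis using A cyclic_least by blast
  qed simp
qed (use assms cyclic_submodule cyclic_neq_zero in auto)

text \<open>Divide a prime p off n, say n = p m. Either m x \<noteq> 0, and p kills this multiple,
  or m x = 0 with |m| < |n| and the induction continues.\<close>

lemma torsion_prime_multiple:
  assumes "x \<in> carrier M" "x \<noteq> \<zero>" "n \<noteq> 0" "n \<odot> x = \<zero>"
  obtains p k where "prime p" "p \<odot> (k \<odot> x) = \<zero>" "k \<odot> x \<noteq> \<zero>"
  using assms(3,4)
proof (induction "nat \<bar>n\<bar>" arbitrary: n thesis rule: less_induct)
  case less
  have "\<not> is_unit n"
    using less.prems(3) assms(1,2) smult_dvd[of x n 1] by auto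
  then obtain p where p: "prime p" "p dvd n"
    using less.prems(2) prime_divisor_exists by blast
  then obtain m where m: "n = p * m" by blast
  show ?case
  proof (cases "m \<odot> x = \<zero>")
    case True
    have "nat \<bar>m\<bar> < nat \<bar>n\<bar>" "m \<noteq> 0"
      using m less.prems(2) prime_gt_1_int[OF p(1)] by (auto simp: abs_mult)
    then show ?thesis using less.hyps less.prems(1) True by blast
  next
    case False
    then show ?thesis
      using less.prems p m assms(1) by (intro less.prems(1)[of p m]) (auto simp: smult_smult)
  qed
qed

text \<open>Every nonzero element of S generates S. This makes x a torsion element, and a multiple
  of x of prime order can then be taken as the generator.\<close>

lemma simple_cyclic:
  assumes S: "simple_submodule \<Z> M S"
  obtains x p where "prime p" "x \<in> carrier M" "x \<noteq> \<zero>" "p \<odot> x = \<zero>" "S = cyclic x"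
proof -
  have sub: "submodule S \<Z> M" and "S \<noteq> {\<zero>}" using S by (auto simp: simple_submodule_def)
  then obtain x where x: "x \<in> S" "x \<noteq> \<zero>" using submodule_zero by blast
  have S_eq: "S = cyclic y" if "y \<in> S" "y \<noteq> \<zero>" for y
  proof -
    have "y \<in> carrier M" using that submodule_carrier[OF sub] by blast
    then have "cyclic y = {\<zero>} \<or> cyclic y = S"
      using S cyclic_submodule cyclic_least[OF sub that(1)] unfolding simple_submodule_def by blast
    then show ?thesis using cyclic_neq_zero[OF \<open>y \<in> carrier M\<close> that(2)] by blast
  qed
  have car: "x \<in> carrier M" using x submodule_carrier[OF sub] by blast
  \<comment> \<open>If 2x \<noteq> 0, then 2x generates S, so x = 2kx and (2k - 1)x = 0. The number
    2k - 1 is odd and so not 0.\<close>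
  obtain n where n: "n \<noteq> 0" "n \<odot> x = \<zero>"
  proof (cases "2 \<odot> x = \<zero>")
    case False
    then have "x \<in> cyclic (2 \<odot> x)"
      using S_eq[of "2 \<odot> x"] x smult_in[OF sub] by auto
    then obtain k where "x = k \<odot> (2 \<odot> x)" unfolding cyclic_def by blast
    then have "1 \<odot> x \<oplus> (2 * k - 1) \<odot> x = 1 \<odot> x"
      using car by (simp only: smult_distribs[symmetric] smult_smult) (simp add: mult.commute)
    then have "(2 * k - 1) \<odot> x = \<zero>"
      using car M.add.r_cancel_one' by auto
    then show thesis by (intro that[of "2 * k - 1"]) presburger+
  qed (auto intro: that[of 2])
  obtain p k where "prime p" "p \<odot> (k \<odot> x) = \<zero>" "k \<odot> x \<noteq> \<zero>"
    using torsion_prime_multiple[OF car x(2) n] .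
  then show thesis
    using car x smult_in[OF sub] S_eq[of "k \<odot> x"] by (intro that) auto
qed

lemma simple_finite: "simple_submodule \<Z> M S \<Longrightarrow> finite S"
  by (metis simple_cyclic finite_cyclic prime_gt_0_int)

lemma semisimple_torsion:
  assumes M: "semisimple_module \<Z> M" and x: "x \<in> carrier M"
  obtains n where "n \<noteq> 0" "n \<odot> x = \<zero>"
proof -
  \<comment> \<open>The torsion submodule. Every simple submodule is generated by an element of
    prime order and so lies in it.\<close>
  define T where "T = {x \<in> carrier M. \<exists>n. n \<noteq> 0 \<and> n \<odot> x = \<zero>}"
  have T: "submodule T \<Z> M"
    unfolding int_submodule_iff
  proof (intro conjI ballI allI)
    show "T \<subseteq> carrier M" "\<zero> \<in> T" by (auto simp: T_def intro: exI[of _ 1])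
    fix x assume "x \<in> T"
    then obtain n where n: "x \<in> carrier M" "n \<noteq> 0" "n \<odot> x = \<zero>" by (auto simp: T_def)
    show "k \<odot> x \<in> T" for k
      using n smult_dvd[of x n "n * k"] by (auto simp: T_def smult_smult intro!: exI[of _ n])
    fix y assume "y \<in> T"
    then obtain m where m: "y \<in> carrier M" "m \<noteq> 0" "m \<odot> y = \<zero>" by (auto simp: T_def)
    have "(n * m) \<odot> (x \<oplus> y) = \<zero>"
      using n m smult_dvd[of x n "n * m"] smult_dvd[of y m "n * m"] by (simp add: smult_distribs)
    then show "x \<oplus> y \<in> T" using n m by (auto simp: T_def intro!: exI[of _ "n * m"])
  qed
  have "S \<subseteq> T" if S: "simple_submodule \<Z> M S" for S
  proof -
    obtain y p where y: "prime p" "y \<in> carrier M" "y \<noteq> \<zero>" "p \<odot> y = \<zero>" "S = cyclic y"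
      using simple_cyclic[OF S] .
    then have "y \<in> T" by (auto simp: T_def intro!: exI[of _ p])
    then show ?thesis using cyclic_least[OF T] y by blast
  qed
  then have "submodule_sum \<Z> M {S. simple_submodule \<Z> M S} \<subseteq> T"
    by (intro submodule_sum_least[OF T]) auto
  then have "x \<in> T" using M x by (auto simp: semisimple_module_def)
  then show thesis using that by (auto simp: T_def)
qed

text \<open>Among all decompositions of M into finitely many simple submodules and a remainder C,
  one with minimal C has C = 0: otherwise C contains a simple submodule that can be split
  off.\<close>

lemma semisimple_artinian_decomposition:
  assumes ss: "semisimple_module \<Z> M" and art: "artinian_module \<Z> M"
  obtains n :: nat and U where "\<forall>i<n. simple_submodule \<Z> M (U i)" "independent_submodules M n U"
    "submodule_sum \<Z> M (U ` {..<n}) = carrier M"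
proof -
  \<comment> \<open>M is the direct sum of the simple submodules U 0, ..., U (n - 1) and of the
    remainder C.\<close>
  define P where "P = (\<lambda>n U C. (\<forall>i<n. simple_submodule \<Z> M (U i)) \<and> independent_submodules M n U \<and>
    submodule C \<Z> M \<and> submodule_sum \<Z> M (U ` {..<n}) \<inter> C = {\<zero>} \<and>
    submodule_sum \<Z> M (U ` {..<n}) <+>\<^bsub>M\<^esub> C = carrier M)"
  have "P 0 (\<lambda>_. {}) (carrier M)"
    using carrier_is_submodule set_add_upper(2)[OF zero_submodule carrier_is_submodule]
      set_add_least[OF carrier_is_submodule, of "{\<zero>}" "carrier M"]
    by (auto simp: P_def independent_submodules_def submodule_sum_empty)
  then have "carrier M \<in> {C. \<exists>n U. P n U C}" by blast
  then obtain C where C: "C \<in> {C. \<exists>n U. P n U C}"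
    and min: "\<And>D. D \<in> {C. \<exists>n U. P n U C} \<Longrightarrow> \<not> D \<subset> C"
    by (rule artinian_minimal[OF art]) (auto simp: P_def)
  then obtain n U where nU: "P n U C" by blast
  define E where "E = submodule_sum \<Z> M (U ` {..<n})"
  have U: "\<And>i. i < n \<Longrightarrow> simple_submodule \<Z> M (U i)" and ind: "independent_submodules M n U"
    and subC: "submodule C \<Z> M" and EC: "E \<inter> C = {\<zero>}" "E <+>\<^bsub>M\<^esub> C = carrier M"
    using nU by (auto simp: P_def E_def)
  have U_sub: "submodule (U i) \<Z> M" if "i < n" for i
    using U[OF that] by (simp add: simple_submodule_def)
  have E: "submodule E \<Z> M"
    unfolding E_def using U_sub by (intro submodule_sum_submodule) auto
  have "C = {\<zero>}"
  proof (rule ccontr)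
    assume "C \<noteq> {\<zero>}"
    then obtain x where x: "x \<in> C" "x \<noteq> \<zero>" using submodule_zero[OF subC] by blast
    then have car: "x \<in> carrier M" using submodule_carrier[OF subC] by blast
    obtain N where "N \<noteq> 0" "N \<odot> x = \<zero>" using semisimple_torsion[OF ss car] .
    then obtain p k where pk: "prime p" "p \<odot> (k \<odot> x) = \<zero>" "k \<odot> x \<noteq> \<zero>"
      using torsion_prime_multiple[OF car x(2)] by blast
    define S where "S = cyclic (k \<odot> x)"
    have simple: "simple_submodule \<Z> M S"
      unfolding S_def using pk car by (intro prime_cyclic_simple) auto
    have SC: "S \<subseteq> C" unfolding S_def using cyclic_least[OF subC] smult_in[OF subC] x by blast
    have S: "submodule S \<Z> M" "S \<noteq> {\<zero>}" using simple by (auto simp: simple_submodule_def)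
    \<comment> \<open>D complements S in all of M. Since S lies in C, the modular law makes C
      \<inter> D a complement of S in C.\<close>
    obtain D where D: "submodule D \<Z> M" "S \<inter> D = {\<zero>}" "S <+>\<^bsub>M\<^esub> D = carrier M"
      using semisimple_complement[OF ss S(1)] .
    define V where "V = U(n := S)"
    have V: "V ` {..<n} = U ` {..<n}" "V n = S" by (auto simp: V_def)
    have V_simple: "simple_submodule \<Z> M (V i)" if "i < Suc n" for i
      using that U simple by (auto simp: V_def less_Suc_eq)
    then have V_sub: "submodule (V i) \<Z> M" if "i < Suc n" for i
      using that by (auto simp: simple_submodule_def)
    have sum: "submodule_sum \<Z> M (V ` {..<Suc n}) = E <+>\<^bsub>M\<^esub> S"
      by (subst submodule_sum_Suc) (use V V_sub E_def in auto)
    have ES: "submodule (E <+>\<^bsub>M\<^esub> S) \<Z> M" by (rule set_add_submodule[OF E S(1)])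
    have CD: "submodule (C \<inter> D) \<Z> M" by (rule Int_submodule[OF subC D(1)])
    have "P (Suc n) V (C \<inter> D)"
      unfolding P_def sum
    proof (intro conjI allI impI)
      show "simple_submodule \<Z> M (V i)" if "i < Suc n" for i by (rule V_simple[OF that])
      show "submodule (C \<inter> D) \<Z> M" by (rule CD)
      show "independent_submodules M (Suc n) V"
        unfolding independent_submodules_def
      proof (intro allI impI)
        fix u i
        assume u: "(\<forall>i<Suc n. u i \<in> V i) \<and> (\<Oplus>i\<in>{..<Suc n}. u i) = \<zero>" and "i < Suc n"
        have u_U: "u j \<in> U j" if "j < n" for j
          using u that unfolding V_def by (metis fun_upd_other less_SucI nat_neq_iff)
        have u_S: "u n \<in> S" using u unfolding V_def by auto
        have u_car: "u j \<in> carrier M" if "j < Suc n" for j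
          using u that submodule_carrier[OF V_sub] by blast
        have sum_E: "(\<Oplus>i\<in>{..<n}. u i) \<in> E"
          using u_U submodule_sum_upper[of _ "U ` {..<n}"]
          by (intro finsum_in_submodule[OF E]) (auto simp: E_def)
        \<comment> \<open>The last component is the negative of an element of E and lies in S
          \<subseteq> C, so it is 0.\<close>
        have "u n \<oplus> (\<Oplus>i\<in>{..<n}. u i) = \<zero>"
          using u u_car by (simp add: lessThan_Suc Pi_def)
        then have "u n \<in> E"
          using submodule_add_cancel[OF E _ sum_E, of "u n"] submodule_zero[OF E] u_car by simp
        then have un: "u n = \<zero>" using EC(1) u_S SC by blast
        moreover from this have "(\<Oplus>i\<in>{..<n}. u i) = \<zero>"
          using \<open>u n \<oplus> (\<Oplus>i\<in>{..<n}. u i) = \<zero>\<close> sum_E submodule_carrier[OF E] by auto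
        ultimately show "u i = \<zero>"
          using ind u_U \<open>i < Suc n\<close> unfolding independent_submodules_def less_Suc_eq by blast
      qed
      show "(E <+>\<^bsub>M\<^esub> S) \<inter> (C \<inter> D) = {\<zero>}"
      proof (intro equalityI subsetI)
        fix y assume y: "y \<in> (E <+>\<^bsub>M\<^esub> S) \<inter> (C \<inter> D)"
        then obtain e s where es: "e \<in> E" "s \<in> S" "y = e \<oplus> s" by (auto simp: set_add_iff)
        have car: "e \<in> carrier M" "s \<in> carrier M"
          using es submodule_carrier E S by auto
        have "e \<in> C" by (rule submodule_add_cancel[OF subC, of e s]) (use es y SC car in auto)
        then have "e = \<zero>" using EC es by blast
        then show "y \<in> {\<zero>}" using es car y D(2) by auto
      qed (use submodule_zero ES CD in auto)
      show "(E <+>\<^bsub>M\<^esub> S) <+>\<^bsub>M\<^esub> (C \<inter> D) = carrier M"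
      proof (intro equalityI subsetI)
        fix y assume "y \<in> carrier M"
        then obtain e c where ec: "e \<in> E" "c \<in> C" "y = e \<oplus> c"
          using EC(2) by (metis set_add_iff)
        then have car: "e \<in> carrier M" "c \<in> carrier M" using submodule_carrier E subC by auto
        then obtain s d where sd: "s \<in> S" "d \<in> D" "c = s \<oplus> d"
          using D(3) by (metis set_add_iff)
        then have car': "s \<in> carrier M" "d \<in> carrier M" using submodule_carrier S D by auto
        have "d \<in> C"
          by (rule submodule_add_cancel[OF subC, of d s])
            (use sd car' SC ec in \<open>auto simp: M.a_comm\<close>)
        moreover have "y = (e \<oplus> s) \<oplus> d" using ec sd car car' by (simp add: M.a_assoc)
        moreover have "e \<oplus> s \<in> E <+>\<^bsub>M\<^esub> S" using ec sd unfolding set_add_iff by blast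
        ultimately show "y \<in> (E <+>\<^bsub>M\<^esub> S) <+>\<^bsub>M\<^esub> (C \<inter> D)"
          using sd unfolding set_add_iff[of y] by blast
      qed (use set_add_submodule[OF ES CD] submodule_carrier in auto)
    qed
    moreover have "C \<inter> D \<subset> C" using D(2) S(2) SC submodule_zero[OF S(1)] by blast
    ultimately show False using min by blast
  qed
  then have "E = carrier M"
    using EC(2) set_add_least[OF E, of E "{\<zero>}"] submodule_zero[OF E] submodule_subset[OF E] by auto
  then show thesis using that U ind unfolding E_def by blast
qed

lemma finite_imp_acc:
  assumes "finite (carrier M)"
  shows "acc_left_annihilators \<Z> M"
  unfolding acc_left_annihilators_def
proof (intro allI impI)
  fix A assume A: "(\<forall>i::nat. left_annihilator \<Z> M (A i)) \<and> (\<forall>i. A i \<subseteq> A (Suc i))"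
  then have "A i \<subseteq> carrier M" for i
    by (auto simp: left_annihilator_def)
  then have "finite (range A)"
    using assms by (intro finite_subset[of "range A" "Pow (carrier M)"]) auto
  moreover have "mono A" using A by (simp add: mono_iff_le_Suc)
  moreover obtain n where "\<forall>X\<in>range A. A n \<subseteq> X \<longrightarrow> A n = X"
    using finite_has_maximal[OF \<open>finite (range A)\<close>] by blast
  ultimately show "\<exists>n. \<forall>m\<ge>n. A m = A n"
    by (metis monoD rangeI)
qed

lemma semisimple_artinian_imp_goldie:
  assumes "semisimple_module \<Z> M" "artinian_module \<Z> M"
  shows "semiprime_goldie_module \<Z> M"
proof -
  obtain n :: nat and U where U: "\<forall>i<n. simple_submodule \<Z> M (U i)"
    "independent_submodules M n U" "submodule_sum \<Z> M (U ` {..<n}) = carrier M"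
    by (rule semisimple_artinian_decomposition[OF assms])
  have "finite (submodule_sum \<Z> M (U ` {..<n}))"
    using U(1) simple_finite by (intro finite_submodule_sum) (auto simp: simple_submodule_def)
  then have "acc_left_annihilators \<Z> M" using U(3) finite_imp_acc by simp
  moreover have "essential_submodule \<Z> M (carrier M)"
    using carrier_is_submodule submodule_subset unfolding essential_submodule_def
    by (metis inf.absorb2)
  then have "finite_uniform_dimension \<Z> M"
    unfolding finite_uniform_dimension_def using U simple_imp_uniform by metis
  ultimately show ?thesis
    using semisimple_imp_semiprime[OF assms(1)]
    by (simp add: semiprime_goldie_module_def goldie_module_def)
qed

end

section \<open>Torsion in semiprime modules\<close>

context int_module
begin

lemma semiprime_square_torsion:
  assumes M: "semiprime_module \<Z> M" and y: "y \<in> carrier M" "(n * n) \<odot> y = \<zero>"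
  shows "n \<odot> y = \<zero>"
proof -
  \<comment> \<open>This is nM \<inter> {x. n x = 0}: an element n x of nM is killed by n exactly
    when n * n kills x.\<close>
  define K where "K = {n \<odot> x | x. x \<in> carrier M \<and> (n * n) \<odot> x = \<zero>}"
  have K: "submodule K \<Z> M"
    unfolding int_submodule_iff
  proof (intro conjI ballI allI)
    show "K \<subseteq> carrier M" by (auto simp: K_def)
    show "\<zero> \<in> K" by (auto simp: K_def intro!: exI[of _ \<zero>])
    fix x assume "x \<in> K"
    then obtain a where a: "a \<in> carrier M" "(n * n) \<odot> a = \<zero>" "x = n \<odot> a" by (auto simp: K_def)
    show "k \<odot> x \<in> K" for k
    proof -
      have "k \<odot> x = n \<odot> (k \<odot> a)" using a by (simp add: smult_smult mult.commute)
      moreover have "(n * n) \<odot> (k \<odot> a) = \<zero>"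
        using a smult_dvd[of a "n * n" "n * n * k"] by (simp add: smult_smult)
      ultimately show ?thesis using a(1) smult_carrier unfolding K_def by blast
    qed
    fix z assume "z \<in> K"
    then obtain b where b: "b \<in> carrier M" "(n * n) \<odot> b = \<zero>" "z = n \<odot> b" by (auto simp: K_def)
    show "x \<oplus> z \<in> K"
    proof -
      have "x \<oplus> z = n \<odot> (a \<oplus> b)" "(n * n) \<odot> (a \<oplus> b) = \<zero>" "a \<oplus> b \<in> carrier M"
        using a b by (simp_all add: smult_distribs)
      then show ?thesis unfolding K_def by blast
    qed
  qed
  have "fully_invariant \<Z> M K"
    unfolding fully_invariant_def
  proof (intro conjI ballI K image_subsetI)
    fix f x assume f: "f \<in> lin_hom \<Z> M M" and "x \<in> K"
    then obtain a where a: "a \<in> carrier M" "(n * n) \<odot> a = \<zero>" "x = n \<odot> a" by (auto simp: K_def)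
    have f': "f a \<in> carrier M" "f (k \<odot> a) = k \<odot> f a" for k
      using f a by (auto simp: lin_hom_def)
    have "(n * n) \<odot> f a = f ((n * n) \<odot> a)" using f' by simp
    also have "\<dots> = 0 \<odot> f a" using a f'(2)[of 0] by simp
    finally have "(n * n) \<odot> f a = \<zero>" using f'(1) by simp
    moreover have "f x = n \<odot> f a" using a f'(2) by simp
    ultimately show "f x \<in> K" using f'(1) unfolding K_def by blast
  qed
  moreover have "submodule_product \<Z> M K K = {\<zero>}"
  proof
    show "submodule_product \<Z> M K K \<subseteq> {\<zero>}"
      unfolding submodule_product_def
    proof (rule submodule_sum_least[OF zero_submodule], safe)
      fix f x assume f: "f \<in> lin_hom \<Z> M (M\<lparr>carrier := K\<rparr>)" and "x \<in> K"
      then obtain a where a: "a \<in> carrier M" "x = n \<odot> a" by (auto simp: K_def)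
      \<comment> \<open>Here f a = n b with (n * n) b = 0, so f x = n (f a) = (n * n) b = 0.\<close>
      have "f a \<in> K" "f x = n \<odot> f a"
        using f a by (auto simp: lin_hom_def)
      moreover from this obtain b where "b \<in> carrier M" "(n * n) \<odot> b = \<zero>" "f a = n \<odot> b"
        by (auto simp: K_def)
      ultimately show "f x = \<zero>" by (simp add: smult_smult)
    qed
    show "{\<zero>} \<subseteq> submodule_product \<Z> M K K"
      using submodule_zero unfolding submodule_product_def submodule_sum_def by blast
  qed
  ultimately have "K = {\<zero>}" using M unfolding semiprime_module_def by blast
  moreover have "n \<odot> y \<in> K" using y unfolding K_def by blast
  ultimately show ?thesis by simp
qed

text \<open>An exponent k + 1 \<ge> 2 drops to k by applying the square case to p^(k - 1) y.
  Exponent 0 means y = 0.\<close>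

lemma semiprime_power_torsion:
  assumes M: "semiprime_module \<Z> M" and y: "y \<in> carrier M" "(p ^ k) \<odot> y = \<zero>"
  shows "p \<odot> y = \<zero>"
  using y(2)
proof (induction k)
  case 0
  then show ?case using y(1) by simp
next
  case (Suc k)
  show ?case
  proof (cases "k = 0")
    case True
    then show ?thesis using Suc.prems by simp
  next
    case False
    then obtain j where j: "k = Suc j" using not0_implies_Suc by blast
    have "(p * p) \<odot> (p ^ j \<odot> y) = p ^ Suc k \<odot> y"
      using y(1) j by (simp add: smult_smult mult.assoc)
    then have "(p * p) \<odot> (p ^ j \<odot> y) = \<zero>" using Suc.prems by simp
    then have "p \<odot> (p ^ j \<odot> y) = \<zero>"
      using semiprime_square_torsion[OF M, of "p ^ j \<odot> y" p] y(1) by simp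
    then show ?thesis using Suc.IH j y(1) by (simp add: smult_smult)
  qed
qed

text \<open>Induction on |n|. If a prime p divides n twice, the square case removes one factor. If n
  = p m with p prime to m, Bezout writes x through p x, which m kills, and m x, which p kills.
  Leaving H abstract lets one induction serve both the essential sum and the sum of the simple
  submodules.\<close>

lemma torsion_prime_generated:
  assumes M: "semiprime_module \<Z> M" and H: "submodule H \<Z> M"
    and prime: "\<And>p x. prime p \<Longrightarrow> x \<in> carrier M \<Longrightarrow> p \<odot> x = \<zero> \<Longrightarrow> x \<in> H"
    and x: "x \<in> carrier M" "n \<noteq> 0" "n \<odot> x = \<zero>"
  shows "x \<in> H"
  using x
proof (induction "nat \<bar>n\<bar>" arbitrary: n x rule: less_induct)
  case less
  show ?case
  proof (cases "is_unit n")
    case True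
    then have "x = \<zero>" using less.prems smult_dvd[of x n 1] by auto
    then show ?thesis using submodule_zero[OF H] by simp
  next
    case False
    then obtain p where p: "prime p" "p dvd n"
      using less.prems(2) prime_divisor_exists by blast
    then obtain m where m: "n = p * m" by blast
    have small: "nat \<bar>m\<bar> < nat \<bar>n\<bar>" "m \<noteq> 0"
      using m less.prems(2) prime_gt_1_int[OF p(1)] by (auto simp: abs_mult)
    show ?thesis
    proof (cases "p dvd m")
      case True
      then obtain r where r: "m = p * r" by blast
      have "(p * p) \<odot> (r \<odot> x) = \<zero>"
        using less.prems m r by (simp add: smult_smult mult_ac)
      then have "m \<odot> x = \<zero>"
        using semiprime_square_torsion[OF M, of "r \<odot> x" p] less.prems(1) r by (simp add: smult_smult)
      then show ?thesis using less.hyps[OF small(1) less.prems(1) small(2)] by blast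
    next
      case False
      then have "coprime p m" using p(1) prime_imp_coprime by blast
      then obtain a b where ab: "x = a \<odot> (p \<odot> x) \<oplus> b \<odot> (m \<odot> x)"
        using coprime_decompose[OF less.prems(1)] by blast
      have "p \<odot> x \<in> H"
        using less.prems(1,3) m by (intro less.hyps[OF small(1) _ small(2)]) (auto simp: smult_smult mult.commute)
      moreover have "m \<odot> x \<in> H"
        using less.prems(1,3) m p(1) by (intro prime[of p]) (auto simp: smult_smult)
      ultimately have "a \<odot> (p \<odot> x) \<oplus> b \<odot> (m \<odot> x) \<in> H"
        using submodule_add[OF H] smult_in[OF H] by blast
      then show ?thesis by (simp only: ab[symmetric])
    qed
  qed
qed

text \<open>U is generated by an element u of prime order p: every x in U turns out to be killed by
  p, and then a nonzero common multiple of x and u puts x into \<open>cyclic u\<close>.\<close>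

lemma uniform_torsion_finite:
  assumes M: "semiprime_module \<Z> M"
    and tors: "\<And>x. x \<in> carrier M \<Longrightarrow> \<exists>n. n \<noteq> 0 \<and> n \<odot> x = \<zero>"
    and U: "uniform_submodule \<Z> M U"
  shows "finite U"
proof -
  have sub: "submodule U \<Z> M" and nz: "U \<noteq> {\<zero>}"
    and uni: "\<And>A B. submodule A \<Z> M \<Longrightarrow> submodule B \<Z> M \<Longrightarrow> A \<subseteq> U \<Longrightarrow> B \<subseteq> U \<Longrightarrow>
            A \<noteq> {\<zero>} \<Longrightarrow> B \<noteq> {\<zero>} \<Longrightarrow> A \<inter> B \<noteq> {\<zero>}"
    using U unfolding uniform_submodule_def by blast+
  \<comment> \<open>The intersection property of U is used only in this form, obtained from the
    cyclic submodules of x and y.\<close>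
  have meet: "\<exists>k l. k \<odot> x = l \<odot> y \<and> k \<odot> x \<noteq> \<zero>" if "x \<in> U" "y \<in> U" "x \<noteq> \<zero>" "y \<noteq> \<zero>" for x y
  proof -
    have xy: "x \<in> carrier M" "y \<in> carrier M" using that submodule_carrier[OF sub] by auto
    then have "cyclic x \<inter> cyclic y \<noteq> {\<zero>}"
      using that by (intro uni cyclic_submodule cyclic_least[OF sub] cyclic_neq_zero)
    moreover have "\<zero> \<in> cyclic x \<inter> cyclic y"
      using xy cyclic_submodule submodule_zero by blast
    ultimately show ?thesis unfolding cyclic_def by blast
  qed
  obtain y where y: "y \<in> U" "y \<noteq> \<zero>" using nz submodule_zero[OF sub] by blast
  then have "y \<in> carrier M" using submodule_carrier[OF sub] by blast
  then obtain N where "N \<noteq> 0" "N \<odot> y = \<zero>" using tors by blast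
  then obtain p k where p: "prime p" "p \<odot> (k \<odot> y) = \<zero>" "k \<odot> y \<noteq> \<zero>"
    using torsion_prime_multiple[OF \<open>y \<in> carrier M\<close> y(2)] by blast
  define u where "u = k \<odot> y"
  have u: "u \<in> U" "u \<in> carrier M" "u \<noteq> \<zero>" "p \<odot> u = \<zero>"
    using p y smult_in[OF sub] \<open>y \<in> carrier M\<close> by (auto simp: u_def)
  have "U \<subseteq> cyclic u"
  proof
    fix x assume x: "x \<in> U"
    then have car: "x \<in> carrier M" using submodule_carrier[OF sub] by blast
    obtain N where N: "N \<noteq> 0" "N \<odot> x = \<zero>" using tors[OF car] by blast
    \<comment> \<open>N is split into its p-part and an m prime to p. Since p^e kills m x, so does
      p; hence m kills p x.\<close>
    obtain e m where m: "N = p ^ e * m" "\<not> p dvd m"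
      using multiplicity_decompose'[of N p] N(1) p(1) not_prime_unit by blast
    have cop: "coprime p m" using m(2) p(1) prime_imp_coprime by blast
    have "p \<odot> (m \<odot> x) = \<zero>"
      by (rule semiprime_power_torsion[OF M, where k = e]) (use car N m(1) in \<open>auto simp: smult_smult\<close>)
    then have mpx: "m \<odot> (p \<odot> x) = \<zero>" using car by (simp add: smult_smult mult.commute)
    \<comment> \<open>A nonzero common multiple of p x and u would be killed by the coprime numbers
      m and p.\<close>
    have "p \<odot> x = \<zero>"
    proof (rule ccontr)
      assume "p \<odot> x \<noteq> \<zero>"
      then obtain k l where kl: "k \<odot> (p \<odot> x) = l \<odot> u" "k \<odot> (p \<odot> x) \<noteq> \<zero>"
        using meet[of "p \<odot> x" u] u x smult_in[OF sub] by blast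
      have "m \<odot> (k \<odot> (p \<odot> x)) = k \<odot> (m \<odot> (p \<odot> x))"
        using car by (simp add: smult_smult mult_ac)
      then have "m \<odot> (k \<odot> (p \<odot> x)) = \<zero>" using mpx by simp
      moreover have "p \<odot> (l \<odot> u) = l \<odot> (p \<odot> u)"
        using u(2) by (simp add: smult_smult mult_ac)
      then have "p \<odot> (k \<odot> (p \<odot> x)) = \<zero>" using kl(1) u(4) by simp
      ultimately show False using coprime_kill[OF _ cop, of "k \<odot> (p \<odot> x)"] kl(2) car by simp
    qed
    show "x \<in> cyclic u"
    proof (cases "x = \<zero>")
      case True
      then show ?thesis using cyclic_submodule[OF u(2)] submodule_zero by blast
    next
      case False
      then obtain k l where kl: "k \<odot> x = l \<odot> u" "k \<odot> x \<noteq> \<zero>"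
        using meet[OF x u(1)] u(3) by blast
      obtain a where "x = a \<odot> (k \<odot> x)"
        using prime_not_kill[OF car p(1) \<open>p \<odot> x = \<zero>\<close> kl(2)] .
      also have "\<dots> = (a * l) \<odot> u" using kl(1) u(2) by (simp only: smult_smult)
      finally show ?thesis unfolding cyclic_def by blast
    qed
  qed
  then show ?thesis
    using finite_cyclic[OF u(2,4)] p(1) prime_gt_0_int finite_subset by blast
qed

text \<open>A nonzero element of prime order generates a simple submodule, which meets the essential
  sum E nontrivially and so lies in E. Thus E and the sum S of the simple submodules contain all
  elements of prime order, hence all of M; as E is finite, so is M.\<close>

lemma torsion_semiprime_goldie_imp_semisimple:
  assumes M: "semiprime_goldie_module \<Z> M"
    and tors: "\<And>x. x \<in> carrier M \<Longrightarrow> \<exists>n. n \<noteq> 0 \<and> n \<odot> x = \<zero>"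
  shows "semisimple_module \<Z> M" "artinian_module \<Z> M"
proof -
  have sp: "semiprime_module \<Z> M" using M by (simp add: semiprime_goldie_module_def)
  obtain n :: nat and U where U: "\<And>i. i < n \<Longrightarrow> uniform_submodule \<Z> M (U i)"
    "essential_submodule \<Z> M (submodule_sum \<Z> M (U ` {..<n}))"
    using M by (auto simp: semiprime_goldie_module_def goldie_module_def finite_uniform_dimension_def)
  define E where "E = submodule_sum \<Z> M (U ` {..<n})"
  have fin: "finite E"
    unfolding E_def using U(1) uniform_torsion_finite[OF sp tors]
    by (intro finite_submodule_sum) (auto simp: uniform_submodule_def)
  have E: "submodule E \<Z> M" using U(2) by (simp add: essential_submodule_def E_def)
  define S where "S = submodule_sum \<Z> M {S. simple_submodule \<Z> M S}"
  have S: "submodule S \<Z> M"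
    unfolding S_def by (intro submodule_sum_submodule) (auto simp: simple_submodule_def)
  have "x \<in> E \<and> x \<in> S" if "prime p" "x \<in> carrier M" "p \<odot> x = \<zero>" for p x
  proof (cases "x = \<zero>")
    case False
    then have simple: "simple_submodule \<Z> M (cyclic x)" using prime_cyclic_simple that by blast
    then have "x \<in> S" using cyclic_self[OF that(2)] submodule_sum_upper unfolding S_def by blast
    have sub: "submodule (cyclic x) \<Z> M" "cyclic x \<noteq> {\<zero>}" using simple by (auto simp: simple_submodule_def)
    then have "E \<inter> cyclic x \<noteq> {\<zero>}" using U(2) by (auto simp: essential_submodule_def E_def)
    moreover have "submodule (E \<inter> cyclic x) \<Z> M" by (rule Int_submodule[OF E sub(1)])
    ultimately have "E \<inter> cyclic x = cyclic x"
      using simple unfolding simple_submodule_def by blast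
    then show ?thesis using cyclic_self[OF that(2)] \<open>x \<in> S\<close> by blast
  qed (use submodule_zero E S in auto)
  then have prime: "x \<in> E" "x \<in> S" if "prime p" "x \<in> carrier M" "p \<odot> x = \<zero>" for p x
    using that by blast+
  have "x \<in> E \<and> x \<in> S" if x: "x \<in> carrier M" for x
  proof -
    obtain N where N: "N \<noteq> 0" "N \<odot> x = \<zero>" using tors[OF x] by blast
    have "x \<in> E" by (rule torsion_prime_generated[OF sp E _ x N]) (rule prime(1))
    moreover have "x \<in> S" by (rule torsion_prime_generated[OF sp S _ x N]) (rule prime(2))
    ultimately show ?thesis ..
  qed
  then have "carrier M \<subseteq> E" and S_eq: "S = carrier M" using submodule_subset[OF S] by auto
  then have finM: "finite (carrier M)" using fin finite_subset by blast
  show "semisimple_module \<Z> M" using S_eq by (simp add: semisimple_module_def S_def)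
  show "artinian_module \<Z> M"
    unfolding artinian_module_def
  proof (intro allI impI)
    fix A assume A: "(\<forall>i::nat. submodule (A i) \<Z> M) \<and> (\<forall>i. A (Suc i) \<subseteq> A i)"
    then have "range A \<subseteq> Pow (carrier M)" using submodule_subset by blast
    then have "finite (range A)" using finM finite_subset by blast
    moreover have "antimono A" using A by (simp add: antimono_iff_le_Suc)
    moreover obtain n where "\<forall>X\<in>range A. X \<subseteq> A n \<longrightarrow> A n = X"
      using finite_has_minimal[OF \<open>finite (range A)\<close>] by blast
    ultimately show "\<exists>n. \<forall>m\<ge>n. A m = A n"
      by (metis antimonoD rangeI)
  qed
qed

end

section \<open>Integer-valued functionals and free modules\<close>

context int_module
begin

text \<open>Linear maps to the integers, as plain functions constrained only on the carrier: neither
  the extensionality of \<open>lin_hom\<close> nor a module record for the target has to be carried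
  along.\<close>

definition functional :: "('a \<Rightarrow> int) \<Rightarrow> bool" where
  "functional c \<longleftrightarrow> (\<forall>x\<in>carrier M. \<forall>y\<in>carrier M. c (x \<oplus> y) = c x + c y) \<and>
     (\<forall>k. \<forall>x\<in>carrier M. c (k \<odot> x) = k * c x)"

lemma functional_add: "functional c \<Longrightarrow> x \<in> carrier M \<Longrightarrow> y \<in> carrier M \<Longrightarrow> c (x \<oplus> y) = c x + c y"
  and functional_smult: "functional c \<Longrightarrow> x \<in> carrier M \<Longrightarrow> c (k \<odot> x) = k * c x"
  by (auto simp: functional_def)

lemma functional_zero: "functional c \<Longrightarrow> c \<zero> = 0"
  using functional_add[of c \<zero> \<zero>] by simp

lemma functional_kernel: "functional c \<Longrightarrow> submodule {x \<in> carrier M. c x = 0} \<Z> M"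
  by (auto simp: int_submodule_iff functional_add functional_smult functional_zero)

text \<open>Division with remainder in the ideal c(N): the smallest nonzero |c b| divides every
  value, since remainders are again values of c on N. If c vanishes on N, the element 0 serves, as 0
  divides 0.\<close>

lemma functional_generator:
  assumes c: "functional c" and N: "submodule N \<Z> M"
  obtains b where "b \<in> N" "\<And>x. x \<in> N \<Longrightarrow> c b dvd c x"
proof (cases "\<exists>x\<in>N. c x \<noteq> 0")
  case False
  then show thesis using that[of \<zero>] submodule_zero[OF N] functional_zero[OF c] by auto
next
  case True
  then obtain b where b: "b \<in> N" "c b \<noteq> 0"
    and min: "\<And>y. y \<in> N \<Longrightarrow> c y \<noteq> 0 \<Longrightarrow> nat \<bar>c b\<bar> \<le> nat \<bar>c y\<bar>"
    using ex_has_least_nat[of "\<lambda>x. x \<in> N \<and> c x \<noteq> 0" _ "\<lambda>x. nat \<bar>c x\<bar>"] by blast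
  have "c b dvd c x" if x: "x \<in> N" for x
  proof -
    define y where "y = x \<oplus> (- (c x div c b)) \<odot> b"
    have "y \<in> N" unfolding y_def by (intro submodule_add[OF N] smult_in[OF N] b x)
    have "c y = c x - c x div c b * c b"
      using submodule_carrier[OF N] b x by (simp add: y_def functional_add[OF c] functional_smult[OF c])
    also have "\<dots> = c x mod c b" by (simp add: minus_div_mult_eq_mod)
    finally have y: "c y = c x mod c b" .
    have "\<bar>c x mod c b\<bar> < \<bar>c b\<bar>" using b(2) by (rule abs_mod_less)
    then have "c y = 0" using min[OF \<open>y \<in> N\<close>] y by fastforce
    then show ?thesis using y by auto
  qed
  then show thesis using b that by blast
qed

text \<open>Bases of submodules N, with the sums taken in M. Extensional coefficient functions turn
  uniqueness of the coefficients into equality of functions.\<close>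

definition basis_of :: "'a set \<Rightarrow> 'a set \<Rightarrow> bool" where
  "basis_of N B \<longleftrightarrow> finite B \<and> B \<subseteq> N \<and>
     (\<forall>x\<in>N. \<exists>!c. c \<in> B \<rightarrow>\<^sub>E UNIV \<and> x = (\<Oplus>b\<in>B. c b \<odot> b))"

lemma free_iff_basis: "free_of_finite_rank \<Z> M \<longleftrightarrow> (\<exists>B. basis_of (carrier M) B)"
  by (simp add: free_of_finite_rank_def basis_of_def)

text \<open>N is the direct sum of the multiples of b and the kernel of c on N, because c b
  generates c(N). The coefficient of b in x is forced to be c x / c b, and the rest has a unique
  expansion in the kernel.\<close>

lemma basis_insert:
  assumes N: "submodule N \<Z> M" and c: "functional c"
    and b: "b \<in> N" "c b \<noteq> 0" "\<And>x. x \<in> N \<Longrightarrow> c b dvd c x"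
    and B: "basis_of (N \<inter> {x \<in> carrier M. c x = 0}) B"
  shows "basis_of N (insert b B)"
proof -
  define N' where "N' = N \<inter> {x \<in> carrier M. c x = 0}"
  have N': "submodule N' \<Z> M"
    unfolding N'_def by (rule Int_submodule[OF N functional_kernel[OF c]])
  have fin: "finite B" and BN': "B \<subseteq> N'"
    and uniq: "\<And>x. x \<in> N' \<Longrightarrow> \<exists>!e. e \<in> B \<rightarrow>\<^sub>E UNIV \<and> x = (\<Oplus>b\<in>B. e b \<odot> b)"
    using B by (auto simp: basis_of_def N'_def)
  have bB: "b \<notin> B" using BN' b(2) by (auto simp: N'_def)
  have car: "b \<in> carrier M" "\<And>x. x \<in> N' \<Longrightarrow> x \<in> carrier M" "B \<subseteq> carrier M"
    using submodule_carrier N N' b BN' by auto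
  have sum_insert: "(\<Oplus>x\<in>insert b B. e x \<odot> x) = e b \<odot> b \<oplus> (\<Oplus>x\<in>B. e x \<odot> x)" for e :: "'a \<Rightarrow> int"
    using fin bB car by (subst M.finsum_insert) auto
  have sum_N': "(\<Oplus>x\<in>B. e x \<odot> x) \<in> N'" for e :: "'a \<Rightarrow> int"
    using BN' by (intro finsum_in_submodule[OF N'] smult_in[OF N']) auto
  have sum_cong: "(\<Oplus>x\<in>B. e x \<odot> x) = (\<Oplus>x\<in>B. e' x \<odot> x)"
    if "\<And>x. x \<in> B \<Longrightarrow> e x = e' x" for e e' :: "'a \<Rightarrow> int"
    using that car(3) by (intro M.finsum_cong') auto
  have "\<exists>!e. e \<in> insert b B \<rightarrow>\<^sub>E UNIV \<and> x = (\<Oplus>b\<in>insert b B. e b \<odot> b)" if x: "x \<in> N" for x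
  proof -
    obtain q where q: "c x = c b * q" using b(3)[OF x] by blast
    have xcar: "x \<in> carrier M" using submodule_carrier[OF N x] .
    define y where "y = x \<oplus> (- q) \<odot> b"
    have "y \<in> N" unfolding y_def by (intro submodule_add[OF N] smult_in[OF N] b x)
    moreover have "c y = 0"
      using xcar car q by (simp add: y_def functional_add[OF c] functional_smult[OF c])
    ultimately have y: "y \<in> N'" using submodule_carrier[OF N] by (auto simp: N'_def)
    have xy: "q \<odot> b \<oplus> y = x"
    proof -
      have "q \<odot> b \<oplus> y = x \<oplus> (q \<odot> b \<oplus> (- q) \<odot> b)"
        using xcar car by (simp add: y_def M.a_ac)
      also have "q \<odot> b \<oplus> (- q) \<odot> b = \<zero>"
        using car(1) smult_distribs(1)[of b q "- q"] by simp
      finally show ?thesis using xcar by simp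
    qed
    from uniq[OF y] obtain e where e: "e \<in> B \<rightarrow>\<^sub>E UNIV \<and> y = (\<Oplus>x\<in>B. e x \<odot> x)"
      and e_uniq: "\<forall>e'. e' \<in> B \<rightarrow>\<^sub>E UNIV \<and> y = (\<Oplus>x\<in>B. e' x \<odot> x) \<longrightarrow> e' = e"
      by (rule ex1E)
    show ?thesis
    proof (rule ex1I[of _ "e(b := q)"], intro conjI)
      show "e(b := q) \<in> insert b B \<rightarrow>\<^sub>E UNIV" using e by (auto simp: PiE_def extensional_def)
      have "(\<Oplus>x\<in>B. (e(b := q)) x \<odot> x) = (\<Oplus>x\<in>B. e x \<odot> x)"
        using bB by (intro sum_cong) auto
      then show "x = (\<Oplus>x\<in>insert b B. (e(b := q)) x \<odot> x)"
        unfolding sum_insert using xy e by simp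
    next
      fix f assume f: "f \<in> insert b B \<rightarrow>\<^sub>E UNIV \<and> x = (\<Oplus>x\<in>insert b B. f x \<odot> x)"
      define z where "z = (\<Oplus>x\<in>B. f x \<odot> x)"
      have z: "z \<in> N'" "z \<in> carrier M" using sum_N' car(2) by (auto simp: z_def)
      have xz: "x = f b \<odot> b \<oplus> z" using f by (simp add: sum_insert z_def)
      then have "c x = f b * c b"
        using z car(1) by (simp add: functional_add[OF c] functional_smult[OF c] N'_def)
      then have fb: "f b = q" using q b(2) by (simp add: mult.commute)
      have "q \<odot> b \<oplus> z = q \<odot> b \<oplus> y" using xz xy fb by simp
      then have "y = z" using car y z by simp
      \<comment> \<open>Uniqueness in the kernel speaks of functions that are extensional on B,
        hence the restriction of f.\<close>
      also have "z = (\<Oplus>x\<in>B. restrict f B x \<odot> x)"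
        unfolding z_def by (intro sum_cong) simp
      finally have "y = (\<Oplus>x\<in>B. restrict f B x \<odot> x)" .
      moreover have "restrict f B \<in> B \<rightarrow>\<^sub>E UNIV" by simp
      ultimately have "restrict f B = e" using spec[OF e_uniq, of "restrict f B"] by blast
      show "f = e(b := q)"
      proof
        fix t show "f t = (e(b := q)) t"
          using f fb bB \<open>restrict f B = e\<close> by (auto simp: PiE_def extensional_def restrict_def)
      qed
    qed
  qed
  then show ?thesis
    using fin BN' b(1) by (auto simp: basis_of_def N'_def)
qed

text \<open>On the kernel of c in N the remaining functionals still separate points, and
  \<open>basis_insert\<close> adds one vector if c is not 0 on N. The induction ranges over all N
  because it moves to that kernel.\<close>

lemma submodule_has_basis:
  assumes "finite F" "submodule N \<Z> M" "\<And>c. c \<in> F \<Longrightarrow> functional c"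
    and "\<And>x. x \<in> N \<Longrightarrow> \<forall>c\<in>F. c x = 0 \<Longrightarrow> x = \<zero>"
  shows "\<exists>B. basis_of N B"
  using assms
proof (induction F arbitrary: N rule: finite_induct)
  case empty
  then have "N = {\<zero>}" using submodule_zero by blast
  then have "basis_of N {}" by (simp add: basis_of_def)
  then show ?case ..
next
  case (insert c F)
  obtain b where b: "b \<in> N" "\<And>x. x \<in> N \<Longrightarrow> c b dvd c x"
    using functional_generator[OF insert.prems(2)[OF insertI1] insert.prems(1)] by blast
  show ?case
  proof (cases "c b = 0")
    case True
    then have "c x = 0" if "x \<in> N" for x using b(2)[OF that] by simp
    then have "x = \<zero>" if "x \<in> N" "\<forall>c\<in>F. c x = 0" for x
      using that insert.prems(3) by blast
    then show ?thesis using insert.IH[OF insert.prems(1)] insert.prems(2) by blast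
  next
    case False
    let ?K = "N \<inter> {x \<in> carrier M. c x = 0}"
    have "submodule ?K \<Z> M" using insert.prems by (intro Int_submodule functional_kernel) auto
    moreover have "x = \<zero>" if "x \<in> ?K" "\<forall>c\<in>F. c x = 0" for x
      using that insert.prems(3) by blast
    ultimately have "\<exists>B. basis_of ?K B" using insert.IH[of ?K] insert.prems(2) by blast
    then obtain B where "basis_of ?K B" ..
    then show ?thesis using basis_insert[OF insert.prems(1) insert.prems(2)[OF insertI1] b(1) False b(2)] by blast
  qed
qed

text \<open>Linearity of the coordinates is uniqueness applied to a sum, or a multiple, of given
  expansions. In the last property e is an arbitrary function, which spares later arguments from
  restricting coefficients.\<close>

lemma basis_coordinates:
  assumes B: "basis_of (carrier M) B"
  obtains co where "\<And>b. b \<in> B \<Longrightarrow> functional (co b)"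
    "\<And>x. x \<in> carrier M \<Longrightarrow> x = (\<Oplus>b\<in>B. co b x \<odot> b)"
    "\<And>e b. b \<in> B \<Longrightarrow> co b (\<Oplus>b\<in>B. e b \<odot> b) = e b"
proof -
  have fin: "finite B" and BM: "B \<subseteq> carrier M"
    and uniq: "\<And>x. x \<in> carrier M \<Longrightarrow> \<exists>!e. e \<in> B \<rightarrow>\<^sub>E UNIV \<and> x = (\<Oplus>b\<in>B. e b \<odot> b)"
    using B by (auto simp: basis_of_def)
  define cf where "cf x = (THE e. e \<in> B \<rightarrow>\<^sub>E UNIV \<and> x = (\<Oplus>b\<in>B. e b \<odot> b))" for x
  have cf: "x = (\<Oplus>b\<in>B. cf x b \<odot> b)" if "x \<in> carrier M" for x
    using theI'[OF uniq[OF that]] unfolding cf_def by blast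
  have cf_sum: "cf (\<Oplus>b\<in>B. e b \<odot> b) b = e b" if "b \<in> B" for e b
  proof -
    let ?x = "\<Oplus>b\<in>B. e b \<odot> b"
    have x: "?x \<in> carrier M" using BM by (intro M.finsum_closed) auto
    have "?x = (\<Oplus>b\<in>B. restrict e B b \<odot> b)" using BM by (intro M.finsum_cong') auto
    then have "restrict e B \<in> B \<rightarrow>\<^sub>E UNIV \<and> ?x = (\<Oplus>b\<in>B. restrict e B b \<odot> b)" by auto
    then have "cf ?x = restrict e B"
      unfolding cf_def using uniq[OF x] by (intro the1_equality) auto
    then show ?thesis using that by simp
  qed
  show thesis
  proof (rule that[of "\<lambda>b x. cf x b"])
    fix b assume b: "b \<in> B"
    show "functional (\<lambda>x. cf x b)"
      unfolding functional_def
    proof (intro conjI ballI allI)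
      fix x y assume xy: "x \<in> carrier M" "y \<in> carrier M"
      have "x \<oplus> y = (\<Oplus>b\<in>B. cf x b \<odot> b) \<oplus> (\<Oplus>b\<in>B. cf y b \<odot> b)"
        using cf xy by metis
      also have "\<dots> = (\<Oplus>b\<in>B. cf x b \<odot> b \<oplus> cf y b \<odot> b)"
        using BM by (subst M.finsum_addf) auto
      also have "\<dots> = (\<Oplus>b\<in>B. (cf x b + cf y b) \<odot> b)"
        using BM by (intro M.finsum_cong') (auto simp: smult_distribs)
      finally show "cf (x \<oplus> y) b = cf x b + cf y b" using cf_sum[OF b] by simp
    next
      fix k x assume x: "x \<in> carrier M"
      have "k \<odot> x = k \<odot> (\<Oplus>b\<in>B. cf x b \<odot> b)" using cf[OF x] by metis
      also have "\<dots> = (\<Oplus>b\<in>B. k \<odot> (cf x b \<odot> b))"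
        using BM fin by (intro finsum_smult_ldistr) auto
      also have "\<dots> = (\<Oplus>b\<in>B. (k * cf x b) \<odot> b)"
        using BM by (intro M.finsum_cong') (auto simp: smult_smult)
      finally show "cf (k \<odot> x) b = k * cf x b" using cf_sum[OF b] by simp
    qed
  qed (use cf cf_sum in auto)
qed

section \<open>Goldie conditions from separating functionals\<close>

lemma left_annihilator_submodule:
  assumes "left_annihilator \<Z> M A"
  shows "submodule A \<Z> M"
proof -
  obtain F where F: "F \<subseteq> lin_hom \<Z> M M" "A = {x \<in> carrier M. \<forall>f\<in>F. f x = \<zero>}"
    using assms by (auto simp: left_annihilator_def)
  have hom: "f (x \<oplus> y) = f x \<oplus> f y" "f (k \<odot> x) = k \<odot> f x"
    if "f \<in> F" "x \<in> carrier M" "y \<in> carrier M" for f x y k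
    using that F(1) by (auto simp: lin_hom_def)
  note hom = hom(1) hom(2)[OF _ _ zero_closed]
  have "f \<zero> = \<zero>" if "f \<in> F" for f
  proof -
    have "f \<in> carrier M \<rightarrow>\<^sub>E carrier M" using that F(1) by (auto simp: lin_hom_def)
    then have "f \<zero> \<in> carrier M" by (rule PiE_mem) simp
    then show ?thesis using hom(2)[OF that, of \<zero> 0] by simp
  qed
  then show ?thesis
    unfolding int_submodule_iff F(2)
  proof (intro conjI ballI allI CollectI)
    fix x y f
    assume "x \<in> {x \<in> carrier M. \<forall>f\<in>F. f x = \<zero>}" "y \<in> {x \<in> carrier M. \<forall>f\<in>F. f x = \<zero>}" "f \<in> F"
    then have "x \<in> carrier M" "y \<in> carrier M" "f x = \<zero>" "f y = \<zero>" and "f \<in> F" by blast+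
    then show "f (x \<oplus> y) = \<zero>" by (simp add: hom(1))
  qed (auto simp: hom(2))
qed

text \<open>The union of the chain is a submodule whose points are separated by F, so it has a
  finite basis, and a finite set lies in one member of the chain.\<close>

lemma finitely_cogenerated_acc:
  assumes "finite F" "\<And>c. c \<in> F \<Longrightarrow> functional c"
    and inj: "\<And>x. x \<in> carrier M \<Longrightarrow> \<forall>c\<in>F. c x = 0 \<Longrightarrow> x = \<zero>"
  shows "acc_left_annihilators \<Z> M"
  unfolding acc_left_annihilators_def
proof (intro allI impI)
  fix A assume A: "(\<forall>i::nat. left_annihilator \<Z> M (A i)) \<and> (\<forall>i. A i \<subseteq> A (Suc i))"
  then have sub: "submodule (A i) \<Z> M" for i using left_annihilator_submodule by blast
  have mono: "A i \<subseteq> A j" if "i \<le> j" for i j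
    using A that by (metis lift_Suc_mono_le)
  have "submodule (\<Union>i. A i) \<Z> M"
    unfolding int_submodule_iff
  proof (intro conjI ballI allI)
    show "(\<Union>i. A i) \<subseteq> carrier M" using sub submodule_subset by blast
    show "\<zero> \<in> (\<Union>i. A i)" using sub submodule_zero by blast
    show "k \<odot> x \<in> (\<Union>i. A i)" if "x \<in> (\<Union>i. A i)" for k x using that sub smult_in by blast
    fix x y assume "x \<in> (\<Union>i. A i)" "y \<in> (\<Union>i. A i)"
    then obtain i j where "x \<in> A i" "y \<in> A j" by blast
    then have "x \<in> A (max i j)" "y \<in> A (max i j)" using mono max.cobounded1 max.cobounded2 by blast+
    then show "x \<oplus> y \<in> (\<Union>i. A i)" using sub submodule_add by blast
  qed
  moreover have "x = \<zero>" if "x \<in> (\<Union>i. A i)" "\<forall>c\<in>F. c x = 0" for x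
    using that inj submodule_carrier[OF sub] by blast
  ultimately obtain B where B: "basis_of (\<Union>i. A i) B"
    using submodule_has_basis[of F "\<Union>i. A i"] assms(1,2) by blast
  then have "finite B" "B \<subseteq> (\<Union>i. A i)" by (auto simp: basis_of_def)
  then have "\<exists>n. B \<subseteq> A n"
  proof (induction B rule: finite_induct)
    case (insert b B)
    then obtain n m where "B \<subseteq> A n" "b \<in> A m" by auto
    then have "insert b B \<subseteq> A (max n m)" using mono max.cobounded1 max.cobounded2 by blast
    then show ?case by blast
  qed simp
  then obtain n where n: "B \<subseteq> A n" ..
  have "A m \<subseteq> A n" for m
  proof
    fix x assume "x \<in> A m"
    then obtain e where "x = (\<Oplus>b\<in>B. e b \<odot> b)" using B unfolding basis_of_def by blast
    then show "x \<in> A n" using n by (auto intro!: finsum_in_submodule[OF sub] smult_in[OF sub])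
  qed
  then show "\<exists>n. \<forall>m\<ge>n. A m = A n" using mono by blast
qed

lemma cogenerated_semiprime:
  assumes F: "\<And>c. c \<in> F \<Longrightarrow> functional c"
    and inj: "\<And>x. x \<in> carrier M \<Longrightarrow> \<forall>c\<in>F. c x = 0 \<Longrightarrow> x = \<zero>"
  shows "semiprime_module \<Z> M"
proof (rule semiprime_moduleI)
  fix K assume "fully_invariant \<Z> M K" and "K \<noteq> {\<zero>}"
  then have K: "submodule K \<Z> M" by (simp add: fully_invariant_def)
  then obtain x where x: "x \<in> K" "x \<noteq> \<zero>" using \<open>K \<noteq> {\<zero>}\<close> submodule_zero by blast
  have car: "x \<in> carrier M" using submodule_carrier[OF K x(1)] .
  obtain c where c: "functional c" "c x \<noteq> 0" using F inj[OF car] x(2) by blast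
  let ?f = "\<lambda>y\<in>carrier M. c y \<odot> x"
  have "?f \<in> lin_hom \<Z> M (M\<lparr>carrier := K\<rparr>)"
    unfolding lin_hom_def
    using smult_in[OF K x(1)] car c(1)
    by (auto simp: functional_add functional_smult smult_distribs smult_smult)
  \<comment> \<open>The functional c takes the value c x * c x at \<open>?f x\<close>, and this is
    not 0.\<close>
  moreover have "?f x \<noteq> \<zero>"
  proof
    assume "?f x = \<zero>"
    then have "c (c x \<odot> x) = 0" using car functional_zero[OF c(1)] by simp
    then show False using c car by (simp add: functional_smult)
  qed
  ultimately show "\<exists>f \<in> lin_hom \<Z> M (M\<lparr>carrier := K\<rparr>). \<exists>x\<in>K. f x \<noteq> \<zero>" using x(1) by blast
qed

text \<open>As c b \<noteq> 0, the element b has infinite order, and nonzero multiples k b and l b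
  have the nonzero common multiple (k * l) b.\<close>

lemma cyclic_uniform:
  assumes c: "functional c" and b: "b \<in> carrier M" "c b \<noteq> 0"
  shows "uniform_submodule \<Z> M (cyclic b)"
  unfolding uniform_submodule_def
proof (intro conjI allI impI)
  show "submodule (cyclic b) \<Z> M" by (rule cyclic_submodule[OF b(1)])
  show "cyclic b \<noteq> {\<zero>}"
    using b functional_zero[OF c] by (intro cyclic_neq_zero) auto
  have nz: "k \<odot> b \<noteq> \<zero>" if "k \<noteq> 0" for k
    using functional_smult[OF c b(1), of k] that b(2) functional_zero[OF c] by auto
  fix A B
  assume AB: "submodule A \<Z> M \<and> submodule B \<Z> M \<and> A \<subseteq> cyclic b \<and> B \<subseteq> cyclic b \<and>
    A \<noteq> {\<zero>} \<and> B \<noteq> {\<zero>}"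
  then obtain x y where "x \<in> A" "x \<noteq> \<zero>" "y \<in> B" "y \<noteq> \<zero>" using submodule_zero by blast
  then obtain k l where kl: "k \<odot> b \<in> A" "k \<odot> b \<noteq> \<zero>" "l \<odot> b \<in> B" "l \<odot> b \<noteq> \<zero>"
    using AB unfolding cyclic_def by blast
  then have "k \<noteq> 0" "l \<noteq> 0" using b(1) by auto
  moreover have "(l * k) \<odot> b \<in> A" "(k * l) \<odot> b \<in> B"
    using AB kl smult_in smult_smult[OF b(1)] by metis+
  ultimately show "A \<inter> B \<noteq> {\<zero>}" using nz[of "k * l"] by (auto simp: mult.commute)
qed

lemma free_imp_semiprime_goldie:
  assumes "free_of_finite_rank \<Z> M"
  shows "semiprime_goldie_module \<Z> M"
proof -
  obtain B where B: "basis_of (carrier M) B" using assms by (auto simp: free_iff_basis)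
  then have fin: "finite B" and BM: "B \<subseteq> carrier M" by (auto simp: basis_of_def)
  obtain co where co: "\<And>b. b \<in> B \<Longrightarrow> functional (co b)"
    "\<And>x. x \<in> carrier M \<Longrightarrow> x = (\<Oplus>b\<in>B. co b x \<odot> b)"
    "\<And>e b. b \<in> B \<Longrightarrow> co b (\<Oplus>b\<in>B. e b \<odot> b) = e b"
    using basis_coordinates[OF B] by blast
  have inj: "x = \<zero>" if "x \<in> carrier M" "\<forall>c\<in>co ` B. c x = 0" for x
  proof -
    have "(\<Oplus>b\<in>B. co b x \<odot> b) = (\<Oplus>b\<in>B. \<zero>)"
      using that(2) BM by (intro M.finsum_cong') auto
    then show ?thesis using co(2)[OF that(1)] by simp
  qed
  \<comment> \<open>The expansion of b has the indicator of b as its coefficients. The value 1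
    supplies the nonvanishing that \<open>cyclic_uniform\<close> asks for.\<close>
  have co_self: "co b b = 1" if "b \<in> B" for b
  proof -
    have "(\<Oplus>a\<in>B. (if b = a then 1 else 0) \<odot> a) = (\<Oplus>a\<in>B. if b = a then a else \<zero>)"
      using BM by (intro M.finsum_cong') auto
    also have "\<dots> = b" using that fin BM by (intro M.finsum_singleton) auto
    finally show ?thesis using co(3)[OF that, of "\<lambda>a. if b = a then 1 else 0"] by simp
  qed
  \<comment> \<open>\<open>finite_uniform_dimension\<close> indexes its submodules by an initial
    segment of the naturals, so B is enumerated by h.\<close>
  obtain h where h: "bij_betw h {..<card B} B"
    using ex_bij_betw_nat_finite[OF fin] by (auto simp: lessThan_atLeast0)
  define U where "U = (\<lambda>i. cyclic (h i))"
  have hB: "h i \<in> B" if "i < card B" for i using h that by (auto simp: bij_betw_def)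
  then have hM: "h i \<in> carrier M" if "i < card B" for i using that BM by blast
  have "uniform_submodule \<Z> M (U i)" if "i < card B" for i
    unfolding U_def using hB[OF that] BM co co_self by (intro cyclic_uniform[of "co (h i)"]) auto
  moreover have "independent_submodules M (card B) U"
    unfolding independent_submodules_def
  proof (intro allI impI)
    fix u i assume u: "(\<forall>i<card B. u i \<in> U i) \<and> (\<Oplus>i\<in>{..<card B}. u i) = \<zero>" and i: "i < card B"
    have "\<forall>i. \<exists>k. i < card B \<longrightarrow> u i = k \<odot> h i"
      using u by (auto simp: U_def cyclic_def)
    then obtain k where k: "\<And>i. i < card B \<Longrightarrow> u i = k i \<odot> h i" by metis
    let ?g = "inv_into {..<card B} h"
    \<comment> \<open>The relation among the u i becomes a relation among basis vectors, whose
      coefficients must all be coordinates of 0.\<close>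
    have "(\<Oplus>b\<in>h ` {..<card B}. k (?g b) \<odot> b) = (\<Oplus>i\<in>{..<card B}. k (?g (h i)) \<odot> h i)"
      using h hB BM by (intro M.finsum_reindex) (auto simp: bij_betw_def)
    also have "\<dots> = (\<Oplus>i\<in>{..<card B}. u i)"
      using h hM k by (intro M.finsum_cong') (auto simp: bij_betw_def)
    also have "\<dots> = \<zero>" using u by simp
    finally have "(\<Oplus>b\<in>B. k (?g b) \<odot> b) = \<zero>" using h by (simp add: bij_betw_def)
    then have "k (?g (h i)) = 0"
      using co(3)[OF hB[OF i], of "\<lambda>b. k (?g b)"] functional_zero[OF co(1)[OF hB[OF i]]] by simp
    then have "k i = 0" using h i by (simp add: bij_betw_def)
    then show "u i = \<zero>" using k[OF i] hB[OF i] BM by auto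
  qed
  moreover have "submodule_sum \<Z> M (U ` {..<card B}) = carrier M"
  proof
    have sub: "submodule (U i) \<Z> M" if "i < card B" for i
      unfolding U_def using hB[OF that] BM by (intro cyclic_submodule) auto
    then have E: "submodule (submodule_sum \<Z> M (U ` {..<card B})) \<Z> M"
      by (intro submodule_sum_submodule) auto
    show "submodule_sum \<Z> M (U ` {..<card B}) \<subseteq> carrier M" by (rule submodule_subset[OF E])
    have "b \<in> submodule_sum \<Z> M (U ` {..<card B})" if b: "b \<in> B" for b
    proof -
      obtain i where i: "i < card B" "b = h i" using h b by (auto simp: bij_betw_def)
      then have "b \<in> U i" using cyclic_self hM by (simp add: U_def)
      moreover have "U i \<subseteq> submodule_sum \<Z> M (U ` {..<card B})"
        using i by (intro submodule_sum_upper) simp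
      ultimately show ?thesis by blast
    qed
    then have sum: "(\<Oplus>b\<in>B. co b x \<odot> b) \<in> submodule_sum \<Z> M (U ` {..<card B})" for x
      by (intro finsum_in_submodule[OF E] smult_in[OF E])
    show "carrier M \<subseteq> submodule_sum \<Z> M (U ` {..<card B})"
    proof
      fix x assume "x \<in> carrier M"
      from sum[of x] show "x \<in> submodule_sum \<Z> M (U ` {..<card B})"
        by (simp only: co(2)[OF \<open>x \<in> carrier M\<close>, symmetric])
    qed
  qed
  moreover have "essential_submodule \<Z> M (carrier M)"
    using carrier_is_submodule submodule_subset unfolding essential_submodule_def by blast
  ultimately have "finite_uniform_dimension \<Z> M"
    unfolding finite_uniform_dimension_def by metis
  moreover have "acc_left_annihilators \<Z> M"
    using fin co(1) inj by (intro finitely_cogenerated_acc[of "co ` B"]) auto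
  moreover have "semiprime_module \<Z> M"
    using co(1) inj by (intro cogenerated_semiprime[of "co ` B"]) auto
  ultimately show ?thesis by (simp add: semiprime_goldie_module_def goldie_module_def)
qed

text \<open>If c v \<noteq> 0, then \<open>cyclic v\<close> meets the kernel of c trivially.
  Uniformity excludes such v from each U, which contains a nonzero element of the kernel;
  essentiality then excludes m.\<close>

lemma functional_uniform_zero:
  assumes c: "functional c" and ess: "essential_submodule \<Z> M (submodule_sum \<Z> M \<U>)"
    and U: "\<And>U. U \<in> \<U> \<Longrightarrow> uniform_submodule \<Z> M U"
    and u: "\<And>U. U \<in> \<U> \<Longrightarrow> \<exists>u\<in>U. u \<noteq> \<zero> \<and> c u = 0"
    and m: "m \<in> carrier M"
  shows "c m = 0"
proof (rule ccontr)
  assume cm: "c m \<noteq> 0"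
  have meet: "cyclic v \<inter> {x \<in> carrier M. c x = 0} = {\<zero>}" if v: "v \<in> carrier M" "c v \<noteq> 0" for v
  proof
    show "cyclic v \<inter> {x \<in> carrier M. c x = 0} \<subseteq> {\<zero>}"
      using v functional_smult[OF c] by (auto simp: cyclic_def)
    show "{\<zero>} \<subseteq> cyclic v \<inter> {x \<in> carrier M. c x = 0}"
      using submodule_zero[OF cyclic_submodule[OF v(1)]] functional_zero[OF c] by simp
  qed
  have "V \<subseteq> {x \<in> carrier M. c x = 0}" if V: "V \<in> \<U>" for V
  proof
    fix v assume v: "v \<in> V"
    have sub: "submodule V \<Z> M" using U[OF V] by (simp add: uniform_submodule_def)
    have car: "v \<in> carrier M" using submodule_carrier[OF sub v] .
    have "c v = 0"
    proof (rule ccontr)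
      assume cv: "c v \<noteq> 0"
      obtain w where w: "w \<in> V" "w \<noteq> \<zero>" "c w = 0" using u[OF V] by blast
      have wcar: "w \<in> carrier M" using submodule_carrier[OF sub w(1)] .
      have "cyclic w \<subseteq> {x \<in> carrier M. c x = 0}"
        using cyclic_least[OF functional_kernel[OF c]] w wcar by simp
      then have "cyclic v \<inter> cyclic w \<subseteq> {\<zero>}" using meet[OF car cv] by blast
      moreover have "\<zero> \<in> cyclic v \<inter> cyclic w"
        using cyclic_submodule submodule_zero car wcar by blast
      ultimately have "cyclic v \<inter> cyclic w = {\<zero>}" by blast
      moreover have "cyclic v \<noteq> {\<zero>}" "cyclic w \<noteq> {\<zero>}"
        using cyclic_neq_zero car wcar w cv functional_zero[OF c] by auto
      ultimately show False
        using U[OF V] cyclic_submodule[OF car] cyclic_submodule[OF wcar]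
          cyclic_least[OF sub v] cyclic_least[OF sub w(1)]
        unfolding uniform_submodule_def by blast
    qed
    then show "v \<in> {x \<in> carrier M. c x = 0}" using car by simp
  qed
  then have "submodule_sum \<Z> M \<U> \<subseteq> {x \<in> carrier M. c x = 0}"
    by (intro submodule_sum_least[OF functional_kernel[OF c]])
  then have "submodule_sum \<Z> M \<U> \<inter> cyclic m \<subseteq> {\<zero>}" using meet[OF m cm] by blast
  moreover have "\<zero> \<in> submodule_sum \<Z> M \<U> \<inter> cyclic m"
    using ess cyclic_submodule[OF m] submodule_zero unfolding essential_submodule_def by blast
  ultimately have "submodule_sum \<Z> M \<U> \<inter> cyclic m = {\<zero>}" by blast
  moreover have "cyclic m \<noteq> {\<zero>}"
    using cyclic_neq_zero m cm functional_zero[OF c] by auto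
  ultimately show False
    using ess cyclic_submodule[OF m] unfolding essential_submodule_def by blast
qed

lemma cogenerated_finite_udim_imp_free:
  assumes F: "\<And>a. a \<in> I \<Longrightarrow> functional (c a)"
    and fin: "\<And>x. x \<in> carrier M \<Longrightarrow> finite {a \<in> I. c a x \<noteq> 0}"
    and inj: "\<And>x. x \<in> carrier M \<Longrightarrow> \<forall>a\<in>I. c a x = 0 \<Longrightarrow> x = \<zero>"
    and udim: "finite_uniform_dimension \<Z> M"
  shows "free_of_finite_rank \<Z> M"
proof -
  obtain n :: nat and U where nU: "\<forall>i<n. uniform_submodule \<Z> M (U i)"
    "essential_submodule \<Z> M (submodule_sum \<Z> M (U ` {..<n}))"
    using udim by (auto simp: finite_uniform_dimension_def)
  have "\<exists>u. u \<in> U i \<and> u \<noteq> \<zero> \<and> u \<in> carrier M" if "i < n" for i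
  proof -
    have "submodule (U i) \<Z> M" "U i \<noteq> {\<zero>}"
      using nU(1) that by (auto simp: uniform_submodule_def)
    then show ?thesis using submodule_zero submodule_carrier by blast
  qed
  then obtain u where u: "\<And>i. i < n \<Longrightarrow> u i \<in> U i \<and> u i \<noteq> \<zero> \<and> u i \<in> carrier M" by metis
  \<comment> \<open>The functionals that do not vanish at some chosen u i. By \<open>fin\<close>
    each u i contributes finitely many, and those of I outside J vanish at all u i, hence
    everywhere.\<close>
  define J where "J = (\<Union>i<n. {a \<in> I. c a (u i) \<noteq> 0})"
  have J: "finite J" "J \<subseteq> I" using fin u by (auto simp: J_def)
  have out: "c a x = 0" if "a \<in> I - J" "x \<in> carrier M" for a x
  proof (rule functional_uniform_zero[OF F nU(2)])
    show "a \<in> I" "x \<in> carrier M" using that by auto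
    fix V assume "V \<in> U ` {..<n}"
    then obtain i where i: "i < n" "V = U i" by auto
    then show "uniform_submodule \<Z> M V" using nU(1) by blast
    have "c a (u i) = 0" using that i(1) by (auto simp: J_def)
    then show "\<exists>u\<in>V. u \<noteq> \<zero> \<and> c a u = 0" using u i by blast
  qed
  have "x = \<zero>" if "x \<in> carrier M" "\<forall>f\<in>c ` J. f x = 0" for x
    using inj[OF that(1)] out that by blast
  then have "\<exists>B. basis_of (carrier M) B"
    using J F carrier_is_submodule by (intro submodule_has_basis[of "c ` J"]) auto
  then show ?thesis by (simp add: free_iff_basis)
qed

end

section \<open>Lifting along the free cover\<close>

text \<open>Every identity in N' is the image under h of an identity in N. Serves for the quotient
  by 0, where h forms singletons, and for copies of a module over another type.\<close>

lemma module_image: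
  assumes N: "module R N"
    and carrier: "carrier N' = h ` carrier N"
    and zero: "\<zero>\<^bsub>N'\<^esub> = h \<zero>\<^bsub>N\<^esub>"
    and add: "\<And>x y. x \<in> carrier N \<Longrightarrow> y \<in> carrier N \<Longrightarrow> h x \<oplus>\<^bsub>N'\<^esub> h y = h (x \<oplus>\<^bsub>N\<^esub> y)"
    and smult: "\<And>r x. r \<in> carrier R \<Longrightarrow> x \<in> carrier N \<Longrightarrow> r \<odot>\<^bsub>N'\<^esub> h x = h (r \<odot>\<^bsub>N\<^esub> x)"
  shows "module R N'"
proof -
  interpret N: module R N by (rule N)
  have "abelian_group N'"
  proof (rule abelian_groupI)
    fix x assume "x \<in> carrier N'"
    then obtain a where a: "a \<in> carrier N" "x = h a" using carrier by auto
    then have "h (\<ominus>\<^bsub>N\<^esub> a) \<in> carrier N'" "h (\<ominus>\<^bsub>N\<^esub> a) \<oplus>\<^bsub>N'\<^esub> x = \<zero>\<^bsub>N'\<^esub>"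
      by (simp_all add: carrier add zero N.l_neg)
    then show "\<exists>y\<in>carrier N'. y \<oplus>\<^bsub>N'\<^esub> x = \<zero>\<^bsub>N'\<^esub>" by blast
  qed (auto simp: carrier add zero N.a_ac)
  then show ?thesis
    using N.R.is_cring
    by (intro moduleI)
      (auto simp: carrier add smult N.smult_l_distr N.smult_r_distr N.smult_assoc1)
qed

text \<open>Closure is a matter of supports: that of a sum lies in the union of the supports, that
  of a multiple in the given support. Negatives are multiples by -1 and so are covered too.\<close>

lemma module_copower:
  assumes "module R M"
  shows "module R (copower I M)"
proof -
  interpret M: module R M by (rule assms)
  have fin_add: "finite {i \<in> I. f i \<oplus>\<^bsub>M\<^esub> g i \<noteq> \<zero>\<^bsub>M\<^esub>}"
    if "finite {i \<in> I. f i \<noteq> \<zero>\<^bsub>M\<^esub>}" "finite {i \<in> I. g i \<noteq> \<zero>\<^bsub>M\<^esub>}" for f g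
    by (rule finite_subset[OF _ finite_UnI[OF that]]) auto
  have fin_smult: "finite {i \<in> I. r \<odot>\<^bsub>M\<^esub> f i \<noteq> \<zero>\<^bsub>M\<^esub>}"
    if "finite {i \<in> I. f i \<noteq> \<zero>\<^bsub>M\<^esub>}" "r \<in> carrier R" for f r
    by (rule finite_subset[OF _ that(1)]) (use that in auto)
  show ?thesis
  proof (rule moduleI)
    show "abelian_group (copower I M)"
    proof (rule abelian_groupI)
      fix f assume f: "f \<in> carrier (copower I M)"
      let ?g = "\<lambda>i\<in>I. (\<ominus>\<^bsub>R\<^esub> \<one>\<^bsub>R\<^esub>) \<odot>\<^bsub>M\<^esub> f i"
      have neg: "(\<ominus>\<^bsub>R\<^esub> \<one>\<^bsub>R\<^esub>) \<odot>\<^bsub>M\<^esub> x \<oplus>\<^bsub>M\<^esub> x = \<zero>\<^bsub>M\<^esub>" if "x \<in> carrier M" for x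
        using that by (simp add: M.smult_l_minus M.l_neg)
      have "?g \<in> carrier (copower I M)"
        using f fin_smult[of f "\<ominus>\<^bsub>R\<^esub> \<one>\<^bsub>R\<^esub>"] by (auto simp: copower_def cong: conj_cong)
      moreover have "?g \<oplus>\<^bsub>copower I M\<^esub> f = \<zero>\<^bsub>copower I M\<^esub>"
        using f neg by (auto simp: copower_def fun_eq_iff)
      ultimately show "\<exists>g\<in>carrier (copower I M). g \<oplus>\<^bsub>copower I M\<^esub> f = \<zero>\<^bsub>copower I M\<^esub>" by blast
    next
      fix f g assume "f \<in> carrier (copower I M)" "g \<in> carrier (copower I M)"
      then show "f \<oplus>\<^bsub>copower I M\<^esub> g \<in> carrier (copower I M)"
        using fin_add[of f g] by (auto simp: copower_def cong: conj_cong)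
    qed (auto simp: copower_def PiE_iff fun_eq_iff restrict_def extensional_def M.a_ac)
    show "r \<odot>\<^bsub>copower I M\<^esub> f \<in> carrier (copower I M)"
      if "r \<in> carrier R" "f \<in> carrier (copower I M)" for r f
      using that fin_smult[of f r] by (auto simp: copower_def cong: conj_cong)
  qed (auto simp: copower_def M.R.is_cring PiE_iff fun_eq_iff restrict_def extensional_def
        M.smult_l_distr M.smult_r_distr M.smult_assoc1)
qed

text \<open>The quotient by the zero submodule consists of singletons and is a copy of the copower,
  so an embedding into a copower provides the subquotient that \<open>in_sigma\<close> asks
  for.\<close>

lemma in_sigma_embedding:
  fixes N :: "('r, 'u) module" and I :: "('u \<times> nat) set"
  assumes M: "module R M" and N: "module R N"
    and e: "e \<in> lin_hom R N (copower I M)" and inj: "inj_on e (carrier N)"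
  shows "in_sigma R M N"
proof -
  define C where "C = copower I M"
  interpret C: module R C unfolding C_def by (rule module_copower[OF M])
  interpret N: module R N by (rule N)
  define Q where "Q = quotient_module C {\<zero>\<^bsub>C\<^esub>}"
  have coset: "{\<zero>\<^bsub>C\<^esub>} +>\<^bsub>C\<^esub> x = {x}" if "x \<in> carrier C" for x
    using that by (simp add: a_r_coset_def')
  have Q: "carrier Q = (\<lambda>x. {x}) ` carrier C" "\<zero>\<^bsub>Q\<^esub> = {\<zero>\<^bsub>C\<^esub>}"
    "\<And>x y. {x} \<oplus>\<^bsub>Q\<^esub> {y} = {x \<oplus>\<^bsub>C\<^esub> y}"
    "\<And>r x. r \<in> carrier R \<Longrightarrow> x \<in> carrier C \<Longrightarrow> r \<odot>\<^bsub>Q\<^esub> {x} = {r \<odot>\<^bsub>C\<^esub> x}"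
    by (auto simp: Q_def quotient_module_def A_RCOSETS_def' set_add_def' coset)
  have "module R Q"
    by (rule module_image[OF C.module_axioms, where h = "\<lambda>x. {x}"]) (auto simp: Q)
  then interpret Q: module R Q .
  have eC: "\<And>x. x \<in> carrier N \<Longrightarrow> e x \<in> carrier C"
    "\<And>x y. x \<in> carrier N \<Longrightarrow> y \<in> carrier N \<Longrightarrow> e x \<oplus>\<^bsub>C\<^esub> e y = e (x \<oplus>\<^bsub>N\<^esub> y)"
    "\<And>r x. r \<in> carrier R \<Longrightarrow> x \<in> carrier N \<Longrightarrow> r \<odot>\<^bsub>C\<^esub> e x = e (r \<odot>\<^bsub>N\<^esub> x)"
    using e by (auto simp: lin_hom_def C_def)
  have e0: "e \<zero>\<^bsub>N\<^esub> = \<zero>\<^bsub>C\<^esub>"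
    using eC(3)[of "\<zero>\<^bsub>R\<^esub>" "\<zero>\<^bsub>N\<^esub>"] eC(1)[of "\<zero>\<^bsub>N\<^esub>"] by simp
  define f where "f = (\<lambda>x\<in>carrier N. {e x})"
  define H where "H = (\<lambda>x. {e x}) ` carrier N"
  have "{\<zero>\<^bsub>C\<^esub>} \<in> H"
    using e0 unfolding H_def by (intro image_eqI[of _ _ "\<zero>\<^bsub>N\<^esub>"]) auto
  then have "submodule H R Q"
    unfolding Q.submodule_iff by (auto simp: Q eC H_def)
  moreover have "submodule {\<zero>\<^bsub>C\<^esub>} R C" by (rule C.zero_submodule)
  moreover have "f \<in> lin_hom R N (Q\<lparr>carrier := H\<rparr>)"
    unfolding lin_hom_def by (auto simp: f_def H_def Q eC)
  moreover have "bij_betw f (carrier N) (carrier (Q\<lparr>carrier := H\<rparr>))"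
    using inj by (auto simp: bij_betw_def f_def H_def inj_on_def)
  ultimately show ?thesis
    using N unfolding in_sigma_def lin_isomorphic_def C_def Q_def by blast
qed

text \<open>Carries a module along an injection into another type, in order to reach the type of
  lists of pairs that \<open>projective_in_sigma\<close> speaks of.\<close>

definition transport :: "('b \<Rightarrow> 'c) \<Rightarrow> ('r, 'b) module \<Rightarrow> ('r, 'c) module" where
  "transport h N = (let g = inv_into (carrier N) h in
     \<lparr>carrier = h ` carrier N, monoid.mult = undefined, one = undefined, zero = h \<zero>\<^bsub>N\<^esub>,
      add = (\<lambda>x y. h (g x \<oplus>\<^bsub>N\<^esub> g y)), smult = (\<lambda>r x. h (r \<odot>\<^bsub>N\<^esub> g x))\<rparr>)"

lemma transport_simps:
  assumes "inj_on h (carrier N)"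
  shows "carrier (transport h N) = h ` carrier N" "\<zero>\<^bsub>transport h N\<^esub> = h \<zero>\<^bsub>N\<^esub>"
    "x \<in> carrier N \<Longrightarrow> y \<in> carrier N \<Longrightarrow> h x \<oplus>\<^bsub>transport h N\<^esub> h y = h (x \<oplus>\<^bsub>N\<^esub> y)"
    "x \<in> carrier N \<Longrightarrow> r \<odot>\<^bsub>transport h N\<^esub> h x = h (r \<odot>\<^bsub>N\<^esub> x)"
  using assms by (simp_all add: transport_def Let_def)

lemma module_transport:
  assumes "module R N" "inj_on h (carrier N)"
  shows "module R (transport h N)"
  by (rule module_image[OF assms(1), where h = h]) (simp_all add: transport_simps[OF assms(2)])

context plain_module
begin

text \<open>The identity of M is lifted along p, through the exact sequence formed by p and its
  kernel. As that sequence must live over lists of pairs, its right end is a copy L of M, and the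
  map actually lifted is the isomorphism h from M to L.\<close>

lemma projective_section:
  fixes N :: "('r, ('r \<times> 'a) list) module" and I :: "(('r \<times> 'a) list \<times> nat) set"
  assumes proj: "projective_in_sigma R M" and N: "module R N"
    and e: "e \<in> lin_hom R N (copower I M)" "inj_on e (carrier N)"
    and p: "p \<in> lin_hom R N M" "p ` carrier N = carrier M"
  obtains s where "s \<in> lin_hom R M N" "\<And>x. x \<in> carrier M \<Longrightarrow> p (s x) = x"
proof -
  interpret N: module R N by (rule N)
  \<comment> \<open>One-element lists code the elements of M; the scalar in them is a
    placeholder.\<close>
  define h where "h = (\<lambda>x::'a. [(undefined :: 'r, x)])"
  have inj_h: "inj_on h A" for A by (auto simp: h_def inj_on_def)
  define L where "L = transport h M"
  note L = transport_simps[OF inj_h[of "carrier M"], folded L_def]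
  have modL: "module R L" unfolding L_def by (rule module_transport[OF module_axioms inj_h])
  have pN: "\<And>x. x \<in> carrier N \<Longrightarrow> p x \<in> carrier M"
    "\<And>x y. x \<in> carrier N \<Longrightarrow> y \<in> carrier N \<Longrightarrow> p (x \<oplus>\<^bsub>N\<^esub> y) = p x \<oplus>\<^bsub>M\<^esub> p y"
    "\<And>r x. r \<in> carrier R \<Longrightarrow> x \<in> carrier N \<Longrightarrow> p (r \<odot>\<^bsub>N\<^esub> x) = r \<odot>\<^bsub>M\<^esub> p x"
    using p(1) by (auto simp: lin_hom_def)
  have p0: "p \<zero>\<^bsub>N\<^esub> = \<zero>\<^bsub>M\<^esub>"
    using pN(3)[of "\<zero>\<^bsub>R\<^esub>" "\<zero>\<^bsub>N\<^esub>"] pN(1)[of "\<zero>\<^bsub>N\<^esub>"] by simp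
  define H where "H = {x \<in> carrier N. p x = \<zero>\<^bsub>M\<^esub>}"
  have H: "submodule H R N"
    unfolding N.submodule_iff H_def by (auto simp: pN p0)
  define K where "K = N\<lparr>carrier := H\<rparr>"
  have modK: "module R K" unfolding K_def by (rule submodule.submodule_is_module[OF H N])
  have "in_sigma R M N" by (rule in_sigma_embedding[OF module_axioms N e])
  moreover have "in_sigma R M K"
  proof (rule in_sigma_embedding[OF module_axioms modK])
    show "restrict e H \<in> lin_hom R K (copower I M)"
      using e(1) H unfolding lin_hom_def K_def
      by (auto simp: H_def N.submodule_add N.submodule_smult pN)
    show "inj_on (restrict e H) (carrier K)"
      using e(2) by (auto simp: K_def H_def inj_on_def)
  qed
  moreover have "in_sigma R M L"
  proof (rule in_sigma_embedding[OF module_axioms modL])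
    \<comment> \<open>A single index makes the copower a copy of M, and \<open>snd (hd l)\<close>
      decodes l.\<close>
    let ?J = "{([], 0)} :: (('r \<times> 'a) list \<times> nat) set"
    let ?e = "\<lambda>l\<in>carrier L. \<lambda>i\<in>?J. snd (hd l)"
    have [simp]: "snd (hd (h x)) = x" for x by (simp add: h_def)
    show "?e \<in> lin_hom R L (copower ?J M)"
      unfolding lin_hom_def by (auto simp: L copower_def split: if_splits)
    show "inj_on ?e (carrier L)"
      by (rule inj_onI) (auto simp: L dest: fun_cong[of _ _ "([], 0)"])
  qed
  moreover have "short_exact R K N L (\<lambda>x\<in>H. x) (\<lambda>x\<in>carrier N. h (p x))"
    unfolding short_exact_def
  proof (intro conjI)
    show "(\<lambda>x\<in>H. x) \<in> lin_hom R K N"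
      using H unfolding lin_hom_def K_def by (auto simp: N.submodule_add N.submodule_smult N.submodule_carrier)
    show "(\<lambda>x\<in>carrier N. h (p x)) \<in> lin_hom R N L"
      unfolding lin_hom_def by (auto simp: L pN)
    show "inj_on (\<lambda>x\<in>H. x) (carrier K)" by (auto simp: K_def inj_on_def)
    show "(\<lambda>x\<in>H. x) ` carrier K = {x \<in> carrier N. (\<lambda>x\<in>carrier N. h (p x)) x = \<zero>\<^bsub>L\<^esub>}"
      by (auto simp: K_def H_def L h_def)
    show "(\<lambda>x\<in>carrier N. h (p x)) ` carrier N = carrier L"
      by (simp add: L p(2)[symmetric] image_image)
  qed
  ultimately have exact: "hom_short_exact R M K N L (\<lambda>x\<in>H. x) (\<lambda>x\<in>carrier N. h (p x))"
    by (intro proj[unfolded projective_in_sigma_def hom_exact_on_sigma_def, rule_format] conjI)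
  have "restrict h (carrier M) \<in> lin_hom R M L"
    unfolding lin_hom_def by (auto simp: L)
  then obtain s where s: "s \<in> lin_hom R M N"
    "restrict h (carrier M) = compose (carrier M) (\<lambda>x\<in>carrier N. h (p x)) s"
    using exact unfolding hom_short_exact_def by (metis (no_types, lifting) imageE)
  show thesis
  proof (rule that[OF s(1)])
    fix x assume x: "x \<in> carrier M"
    have "s x \<in> carrier N" using s(1) x by (auto simp: lin_hom_def)
    then have "h x = h (p (s x))" using fun_cong[OF s(2), of x] x by (simp add: compose_def)
    then show "p (s x) = x" by (simp add: h_def)
  qed
qed

end

section \<open>The free module on the carrier and the dual basis\<close>

definition int_self_module :: "(int, int) module" where
  "int_self_module = \<lparr>carrier = UNIV, monoid.mult = (*), one = 1, zero = 0, add = (+), smult = (*)\<rparr>"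

lemma module_int_self: "module \<Z> int_self_module"
  unfolding int_self_module_def
  by (intro moduleI abelian_groupI int_is_cring) (auto simp: algebra_simps intro: exI[of _ "- _"])

text \<open>A finitely supported function is determined by the finite set of its pairs (value,
  index) with nonzero value, and any list that enumerates this set serves as its code.\<close>

lemma free_code:
  obtains code :: "('a \<Rightarrow> int) \<Rightarrow> (int \<times> 'a) list"
  where "inj_on code (carrier (copower I int_self_module))"
proof -
  define S where "S f = (\<lambda>a. (f a, a)) ` {a \<in> I. f a \<noteq> 0}" for f :: "'a \<Rightarrow> int"
  define code where "code f = (SOME xs. set xs = S f)" for f
  have code: "set (code f) = S f" if "f \<in> carrier (copower I int_self_module)" for f
  proof -
    have "finite (S f)" using that by (simp add: S_def copower_def int_self_module_def)
    then have "\<exists>xs. set xs = S f" by (rule finite_list)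
    then show ?thesis unfolding code_def by (rule someI_ex)
  qed
  have "inj_on code (carrier (copower I int_self_module))"
  proof (rule inj_onI)
    fix f g assume fg: "f \<in> carrier (copower I int_self_module)"
      "g \<in> carrier (copower I int_self_module)" "code f = code g"
    have S: "S f = S g" using code[OF fg(1)] code[OF fg(2)] fg(3) by simp
    show "f = g"
    proof (rule extensionalityI)
      show "f \<in> extensional I" "g \<in> extensional I" using fg by (auto simp: copower_def PiE_def)
      fix a assume "a \<in> I"
      then have "f a = 0 \<or> (f a, a) \<in> S f" "g a = 0 \<or> (g a, a) \<in> S g" by (auto simp: S_def)
      then show "f a = g a" using S by (auto simp: S_def)
    qed
  qed
  then show thesis by (rule that)
qed

context int_module
begin

text \<open>The canonical map from the free module on the carrier of M to M, which sends the basis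
  vector of a to a. Summing over the support keeps the sum finite even if the carrier is
  infinite.\<close>

definition evaluate :: "('a \<Rightarrow> int) \<Rightarrow> 'a" where
  "evaluate f = (\<Oplus>a\<in>{a \<in> carrier M. f a \<noteq> 0}. f a \<odot> a)"

text \<open>Lets functions with different supports be summed over one common finite set, as
  additivity requires.\<close>

lemma evaluate_superset:
  assumes "finite A" "{a \<in> carrier M. f a \<noteq> 0} \<subseteq> A" "A \<subseteq> carrier M"
  shows "evaluate f = (\<Oplus>a\<in>A. f a \<odot> a)"
  unfolding evaluate_def using assms by (intro M.add.finprod_mono_neutral_cong_left) auto

lemma evaluate_hom:
  "(\<lambda>f\<in>carrier (copower (carrier M) int_self_module). evaluate f)
    \<in> lin_hom \<Z> (copower (carrier M) int_self_module) M"
  (is "?ev \<in> lin_hom \<Z> ?F M")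
  unfolding lin_hom_def
proof (intro CollectI conjI ballI)
  have F: "module \<Z> ?F" by (rule module_copower[OF module_int_self])
  interpret F: int_module ?F
    using F by (simp add: int_module_def plain_module_def)
  have fin: "finite {a \<in> carrier M. f a \<noteq> 0}" if "f \<in> carrier ?F" for f
    using that by (simp add: copower_def int_self_module_def)
  show "?ev \<in> carrier ?F \<rightarrow>\<^sub>E carrier M"
    by (auto simp: evaluate_def intro!: M.finsum_closed)
  fix f assume f: "f \<in> carrier ?F"
  {
    fix g assume g: "g \<in> carrier ?F"
    let ?A = "{a \<in> carrier M. f a \<noteq> 0} \<union> {a \<in> carrier M. g a \<noteq> 0}"
    have A: "finite ?A" "?A \<subseteq> carrier M" using fin f g by auto
    have fg: "(f \<oplus>\<^bsub>?F\<^esub> g) a = f a + g a" if "a \<in> carrier M" for a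
      using that by (simp add: copower_def int_self_module_def)
    have "evaluate (f \<oplus>\<^bsub>?F\<^esub> g) = (\<Oplus>a\<in>?A. (f \<oplus>\<^bsub>?F\<^esub> g) a \<odot> a)"
      using fg by (intro evaluate_superset A) auto
    also have "\<dots> = (\<Oplus>a\<in>?A. f a \<odot> a \<oplus> g a \<odot> a)"
      using fg by (intro M.finsum_cong') (auto simp: smult_distribs)
    also have "\<dots> = (\<Oplus>a\<in>?A. f a \<odot> a) \<oplus> (\<Oplus>a\<in>?A. g a \<odot> a)"
      by (intro M.finsum_addf) auto
    also have "(\<Oplus>a\<in>?A. f a \<odot> a) = evaluate f"
      by (intro evaluate_superset[symmetric] A) auto
    also have "(\<Oplus>a\<in>?A. g a \<odot> a) = evaluate g"
      by (intro evaluate_superset[symmetric] A) auto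
    finally show "?ev (f \<oplus>\<^bsub>?F\<^esub> g) = ?ev f \<oplus> ?ev g" using f g by simp
  }
  fix k :: int
  let ?A = "{a \<in> carrier M. f a \<noteq> 0}"
  have kf: "(k \<odot>\<^bsub>?F\<^esub> f) a = k * f a" if "a \<in> carrier M" for a
    using that by (simp add: copower_def int_self_module_def)
  have "evaluate (k \<odot>\<^bsub>?F\<^esub> f) = (\<Oplus>a\<in>?A. (k \<odot>\<^bsub>?F\<^esub> f) a \<odot> a)"
    using kf fin[OF f] by (intro evaluate_superset) auto
  also have "\<dots> = (\<Oplus>a\<in>?A. k \<odot> (f a \<odot> a))"
    using kf by (intro M.finsum_cong') (auto simp: smult_smult)
  also have "\<dots> = k \<odot> evaluate f"
    unfolding evaluate_def using fin[OF f] by (intro finsum_smult_ldistr[symmetric]) auto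
  finally show "?ev (k \<odot>\<^bsub>?F\<^esub> f) = k \<odot> ?ev f" using f by simp
qed

lemma evaluate_unit:
  assumes "x \<in> carrier M"
  shows "evaluate (\<lambda>a\<in>carrier M. if a = x then 1 else 0) = x"
proof -
  have "{a \<in> carrier M. (\<lambda>a\<in>carrier M. if a = x then 1 else 0 :: int) a \<noteq> 0} = {x}"
    using assms by auto
  then show ?thesis using assms by (simp add: evaluate_def)
qed

text \<open>The dual basis lemma: for a section of the canonical map with coordinates c a, each x is
  the sum of c a x \<odot> a over the finitely many a with c a x \<noteq> 0. This sum is empty if
  all coordinates of x vanish.\<close>

lemma projective_dual_basis:
  assumes proj: "projective_in_sigma \<Z> M"
    and x0: "x0 \<in> carrier M" "\<And>k. k \<odot> x0 = \<zero> \<Longrightarrow> k = 0"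
  obtains c where "\<And>a. a \<in> carrier M \<Longrightarrow> functional (c a)"
    "\<And>x. x \<in> carrier M \<Longrightarrow> finite {a \<in> carrier M. c a x \<noteq> 0}"
    "\<And>x. x \<in> carrier M \<Longrightarrow> \<forall>a\<in>carrier M. c a x = 0 \<Longrightarrow> x = \<zero>"
proof -
  define F where "F = copower (carrier M) int_self_module"
  have modF: "module \<Z> F" unfolding F_def by (rule module_copower[OF module_int_self])
  have F: "f \<in> carrier F \<longleftrightarrow> f \<in> extensional (carrier M) \<and> finite {a \<in> carrier M. f a \<noteq> 0}"
    "a \<in> carrier M \<Longrightarrow> (f \<oplus>\<^bsub>F\<^esub> g) a = f a + g a"
    "a \<in> carrier M \<Longrightarrow> (k \<odot>\<^bsub>F\<^esub> f) a = k * f a" for f g a k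
    by (auto simp: F_def copower_def int_self_module_def PiE_def)
  interpret F: int_module F using modF by (simp add: int_module_def plain_module_def)
  obtain code :: "('a \<Rightarrow> int) \<Rightarrow> (int \<times> 'a) list" where code: "inj_on code (carrier F)"
    using free_code unfolding F_def .
  define N where "N = transport code F"
  note N = transport_simps[OF code, folded N_def]
  have modN: "module \<Z> N" unfolding N_def by (rule module_transport[OF modF code])
  define dec where "dec = inv_into (carrier F) code"
  have dec [simp]: "dec (code f) = f" if "f \<in> carrier F" for f
    using that code by (simp add: dec_def)
  \<comment> \<open>\<open>in_sigma\<close> takes its indices from pairs of a list and a natural
    number, so an element a of M is coded as ([(0, a)], 0) and read back by
    \<open>index\<close>.\<close>
  define I :: "((int \<times> 'a) list \<times> nat) set" where "I = (\<lambda>a. ([(0, a)], 0)) ` carrier M"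
  define index where "index i = snd (hd (fst i))" for i :: "(int \<times> 'a) list \<times> nat"
  have index: "index ([(0, a)], 0) = a" for a by (simp add: index_def)
  have index_I: "index i \<in> carrier M" if "i \<in> I" for i using that by (auto simp: I_def index)
  \<comment> \<open>In each coordinate this is k \<mapsto> k x0. It embeds the free module into a
    copower of M because x0 has infinite order.\<close>
  define e where "e = (\<lambda>n\<in>carrier N. \<lambda>i\<in>I. dec n (index i) \<odot> x0)"
  have x0_inj: "k = l" if "k \<odot> x0 = l \<odot> x0" for k l
  proof -
    have "(k - l) \<odot> x0 \<oplus> l \<odot> x0 = k \<odot> x0"
      using smult_distribs(1)[OF x0(1), of "k - l" l] by simp
    then have "(k - l) \<odot> x0 = \<zero>"
      using that x0(1) M.add.r_cancel_one'[of "(k - l) \<odot> x0" "l \<odot> x0"] by simp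
    then show ?thesis using x0(2)[of "k - l"] by simp
  qed
  have fin_I: "finite {i \<in> I. f (index i) \<odot> x0 \<noteq> \<zero>}" if "f \<in> carrier F" for f
  proof (rule finite_subset)
    show "{i \<in> I. f (index i) \<odot> x0 \<noteq> \<zero>} \<subseteq> (\<lambda>a. ([(0, a)], 0)) ` {a \<in> carrier M. f a \<noteq> 0}"
      using x0(1) by (auto simp: I_def index)
    show "finite ((\<lambda>a. ([(0::int, a)], 0::nat)) ` {a \<in> carrier M. f a \<noteq> 0})"
      using that by (simp add: F(1))
  qed
  have "e \<in> lin_hom \<Z> N (copower I M)"
    unfolding lin_hom_def
  proof (intro CollectI conjI ballI)
    show "e \<in> carrier N \<rightarrow>\<^sub>E carrier (copower I M)"
      using fin_I x0(1) by (auto simp: e_def N copower_def cong: conj_cong)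
    fix n assume "n \<in> carrier N"
    then obtain f where f: "f \<in> carrier F" "n = code f" by (auto simp: N)
    show "e (k \<odot>\<^bsub>N\<^esub> n) = k \<odot>\<^bsub>copower I M\<^esub> e n" for k
      using f x0(1) index_I F.smult_carrier[OF f(1), of k]
      by (auto simp: e_def N F(2,3) copower_def smult_smult fun_eq_iff)
    fix n' assume "n' \<in> carrier N"
    then obtain g where g: "g \<in> carrier F" "n' = code g" by (auto simp: N)
    show "e (n \<oplus>\<^bsub>N\<^esub> n') = e n \<oplus>\<^bsub>copower I M\<^esub> e n'"
      using f g x0(1) index_I F.a_closed[OF f(1) g(1)]
      by (auto simp: e_def N F(2,3) copower_def smult_distribs fun_eq_iff)
  qed
  moreover have "inj_on e (carrier N)"
  proof (rule inj_onI)
    fix n n' assume nn: "n \<in> carrier N" "n' \<in> carrier N" "e n = e n'"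
    then obtain f g where fg: "f \<in> carrier F" "n = code f" "g \<in> carrier F" "n' = code g"
      by (auto simp: N)
    have "f = g"
    proof (rule extensionalityI)
      show "f \<in> extensional (carrier M)" "g \<in> extensional (carrier M)" using fg F(1) by auto
      fix a assume a: "a \<in> carrier M"
      then have "([(0, a)], 0) \<in> I" by (auto simp: I_def)
      then have "f a \<odot> x0 = g a \<odot> x0"
        using fun_cong[OF nn(3), of "([(0, a)], 0)"] fg by (auto simp: e_def N index)
      then show "f a = g a" by (rule x0_inj)
    qed
    then show "n = n'" using fg by simp
  qed
  moreover define p where "p = (\<lambda>n\<in>carrier N. evaluate (dec n))"
  have ev: "evaluate f \<in> carrier M" "evaluate (f \<oplus>\<^bsub>F\<^esub> g) = evaluate f \<oplus> evaluate g"
    "evaluate (k \<odot>\<^bsub>F\<^esub> f) = k \<odot> evaluate f" if "f \<in> carrier F" "g \<in> carrier F" for f g k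
    using evaluate_hom that F.a_closed[OF that] F.smult_carrier[OF that(1), of k]
    unfolding lin_hom_def F_def[symmetric] by auto
  have "p \<in> lin_hom \<Z> N M"
    unfolding lin_hom_def
  proof (intro CollectI conjI ballI)
    show "p \<in> carrier N \<rightarrow>\<^sub>E carrier M" using ev(1) by (auto simp: p_def N)
    fix n assume "n \<in> carrier N"
    then obtain f where f: "f \<in> carrier F" "n = code f" by (auto simp: N)
    show "p (k \<odot>\<^bsub>N\<^esub> n) = k \<odot> p n" for k
      using f ev(3)[OF f(1) f(1)] by (simp add: p_def N)
    fix n' assume "n' \<in> carrier N"
    then obtain g where g: "g \<in> carrier F" "n' = code g" by (auto simp: N)
    show "p (n \<oplus>\<^bsub>N\<^esub> n') = p n \<oplus> p n'"
      using f g ev(2)[OF f(1) g(1)] by (simp add: p_def N)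
  qed
  moreover have "p ` carrier N = carrier M"
  proof
    show "p ` carrier N \<subseteq> carrier M" using ev(1) by (auto simp: p_def N)
    show "carrier M \<subseteq> p ` carrier N"
    proof
      fix x assume x: "x \<in> carrier M"
      let ?d = "\<lambda>a\<in>carrier M. if a = x then 1 else 0 :: int"
      have "finite {a \<in> carrier M. ?d a \<noteq> 0}"
        by (rule finite_subset[of _ "{x}"]) auto
      then have "?d \<in> carrier F" by (simp add: F(1))
      then have "code ?d \<in> carrier N" "p (code ?d) = x"
        using evaluate_unit[OF x] by (simp_all add: N p_def)
      then show "x \<in> p ` carrier N" by force
    qed
  qed
  ultimately obtain s where s: "s \<in> lin_hom \<Z> M N" "\<And>x. x \<in> carrier M \<Longrightarrow> p (s x) = x"
    using projective_section[OF proj modN] by blast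
  define c where "c a x = dec (s x) a" for a x
  have s_dec: "\<exists>f. f \<in> carrier F \<and> s x = code f" if "x \<in> carrier M" for x
  proof -
    have "s x \<in> carrier N" using s(1) that by (auto simp: lin_hom_def)
    then show ?thesis by (auto simp: N)
  qed
  have hom: "s (x \<oplus> y) = s x \<oplus>\<^bsub>N\<^esub> s y" "s (k \<odot> x) = k \<odot>\<^bsub>N\<^esub> s x"
    if "x \<in> carrier M" "y \<in> carrier M" for x y k
    using s(1) that by (auto simp: lin_hom_def)
  show thesis
  proof (rule that[of c])
    fix a assume a: "a \<in> carrier M"
    show "functional (c a)"
      unfolding functional_def
    proof (intro conjI ballI allI)
      fix x assume x: "x \<in> carrier M"
      obtain f where f: "f \<in> carrier F" "s x = code f" using s_dec[OF x] by blast
      show "c a (k \<odot> x) = k * c a x" for k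
        using f hom(2)[OF x x] a by (simp add: c_def N F(2,3))
      fix y assume y: "y \<in> carrier M"
      obtain g where g: "g \<in> carrier F" "s y = code g" using s_dec[OF y] by blast
      show "c a (x \<oplus> y) = c a x + c a y"
        using f g hom(1)[OF x y] a by (simp add: c_def N F(2,3))
    qed
  next
    fix x assume x: "x \<in> carrier M"
    obtain f where f: "f \<in> carrier F" "s x = code f" using s_dec[OF x] by blast
    show "finite {a \<in> carrier M. c a x \<noteq> 0}" using f by (simp add: c_def F)
    assume "\<forall>a\<in>carrier M. c a x = 0"
    then have none: "{a \<in> carrier M. f a \<noteq> 0} = {}" using f by (auto simp: c_def)
    have "s x \<in> carrier N" using f by (simp add: N)
    then have "x = evaluate f" using s(2)[OF x] f by (simp add: p_def)
    then show "x = \<zero>" unfolding evaluate_def none by simp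
  qed
qed

end

theorem mainTheorem4:
  fixes M :: "(int, 'a) module"
  assumes "module \<Z> M"
    and "projective_in_sigma \<Z> M"
  shows "semiprime_goldie_module \<Z> M \<longleftrightarrow>
         (semisimple_module \<Z> M \<and> artinian_module \<Z> M) \<or> free_of_finite_rank \<Z> M"
proof -
  interpret int_module M
    using assms(1) by (simp add: int_module_def plain_module_def)
  show ?thesis
  proof (intro iffI)
    assume M: "semiprime_goldie_module \<Z> M"
    show "(semisimple_module \<Z> M \<and> artinian_module \<Z> M) \<or> free_of_finite_rank \<Z> M"
    proof (cases "\<forall>x\<in>carrier M. \<exists>n. n \<noteq> 0 \<and> n \<odot>\<^bsub>M\<^esub> x = \<zero>\<^bsub>M\<^esub>")
      case True
      then show ?thesis using torsion_semiprime_goldie_imp_semisimple[OF M] by blast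
    next
      case False
      then obtain x0 where "x0 \<in> carrier M" "\<And>k. k \<odot>\<^bsub>M\<^esub> x0 = \<zero>\<^bsub>M\<^esub> \<Longrightarrow> k = 0" by blast
      then obtain c where "\<And>a. a \<in> carrier M \<Longrightarrow> functional (c a)"
        "\<And>x. x \<in> carrier M \<Longrightarrow> finite {a \<in> carrier M. c a x \<noteq> 0}"
        "\<And>x. x \<in> carrier M \<Longrightarrow> \<forall>a\<in>carrier M. c a x = 0 \<Longrightarrow> x = \<zero>\<^bsub>M\<^esub>"
        using projective_dual_basis[OF assms(2)] by blast
      moreover have "finite_uniform_dimension \<Z> M"
        using M by (simp add: semiprime_goldie_module_def goldie_module_def)
      ultimately show ?thesis
        using cogenerated_finite_udim_imp_free[of "carrier M" c] by blast
    qed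
  next
    assume "(semisimple_module \<Z> M \<and> artinian_module \<Z> M) \<or> free_of_finite_rank \<Z> M"
    then show "semiprime_goldie_module \<Z> M"
      using semisimple_artinian_imp_goldie free_imp_semiprime_goldie by blast
  qed
qed

end
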